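(* Let $\nu>0$, $T>0$, and let $\alpha,\beta$ satisfy $\frac12<\beta<\frac54$ and $\alpha+\beta=\frac54$. Let $r>\beta+2$. Given initial conditions $v_{1,0},v_{2,0}\in V^r$ and $\theta_{1,0},\theta_{2,0}\in H^{r-\beta}$, let $(v_i,\theta_i)$, $i=1,2$, be the solutions on $[0,T]$ of the system \[ \partial_t v+B(u,v)+\nu\Lambda^{2\beta}v=\Pi(\theta e_3),\qquad \partial_t\theta+u\cdot\nabla\theta=0,\qquad v=\Lambda^{2\alpha}u, \] with data $(v_{i,0},\theta_{i,0})$ and regularity $v_i\in C([0,T];V^r)\cap L^2(0,T;V^{r+\beta})$, $\theta_i\in C([0,T];H^{r-\beta})$. Then \[ \|v_1-v_2\|_{L^\infty(0,T;V^{r-1})}+\|v_1-v_2\|_{L^2(0,T;V^{r-1+\beta})}+\|\theta_1-\theta_2\|_{L^\infty(0,T;H^{r-\beta-1})} \le C\big(\|v_{1,0}-v_{2,0}\|_{V^{r-1}}+\|\theta_{1,0}-\theta_{2,0}\|_{H^{r-\beta-1}}\big), \] where the constant $C$ depends on $T$, $\|\theta_1\|_{L^\infty(0,T;H^{r-\beta})}$, $\|v_i\|_{L^2(0,T;V^{r+\beta-1})}$ and $\|v_i\|_{L^\infty(0,T;V^r)}$ ($i=1,2$).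
   Context: Let $\mathbb T=[0,2\pi]^3$ with periodic boundary conditions. For $s\in\mathbb R$, $H^s$ is the space of real periodic functions/distributions $f=\sum_{k\in\mathbb Z^3\setminus\{0\}}f_ke^{ik\cdot x}$ (zero mean) with $f_{-k}=\overline{f_k}$ and $\|f\|_{H^s}^2=\sum_k|f_k|^2|k|^{2s}<\infty$. $V^s$ is the analogous space of vector fields $w=\sum_{k\neq0}w_ke^{ik\cdot x}$, $w_k\in\mathbb C^3$, $w_{-k}=\overline{w_k}$, $w_k\cdot k=0$ (divergence free, zero mean), with $\|w\|_{V^s}^2=\sum_k|w_k|^2|k|^{2s}$. $\Lambda^s$ is the Fourier multiplier by $|k|^s$. $\Pi$ is the Leray–Helmholtz projection onto divergence-free fields; $B(u,v)=\Pi((u\cdot\nabla)v)$. $e_3=(0,0,1)$. Solutions are understood in the weak (distributional) sense with $u=\Lambda^{-2\alpha}v$; for such data, solutions with the stated regularity exist and are unique. *)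

theory Defs
  imports "HOL-Analysis.Analysis"
begin

text \<open>Fourier-side representation of periodic objects on the torus [0,2pi]^3.
  A scalar function/distribution is given by its Fourier coefficients indexed by
  wave vectors k in Z^3; a vector field by coefficients in C^3.\<close>

type_synonym freq = "int ^ 3"
type_synonym sfield = "freq \<Rightarrow> complex"
type_synonym vfield = "freq \<Rightarrow> complex ^ 3"

definition knorm :: "freq \<Rightarrow> real" where
  "knorm k = sqrt (\<Sum>i\<in>UNIV. (real_of_int (k $ i))^2)"

definition sobsq :: "real \<Rightarrow> (freq \<Rightarrow> 'a::real_normed_vector) \<Rightarrow> ennreal" where
  "sobsq s f = (\<integral>\<^sup>+ k. ennreal ((norm (f k))^2 * knorm k powr (2 * s)) \<partial>count_space (UNIV - {0}))"

definition sobnorm :: "real \<Rightarrow> (freq \<Rightarrow> 'a::real_normed_vector) \<Rightarrow> real" where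
  "sobnorm s f = sqrt (enn2real (sobsq s f))"

definition vcnj :: "complex ^ 3 \<Rightarrow> complex ^ 3" where
  "vcnj w = (\<chi> i. cnj (w $ i))"

definition kvec :: "freq \<Rightarrow> complex ^ 3" where
  "kvec k = (\<chi> i. of_int (k $ i))"

definition cdot :: "complex ^ 3 \<Rightarrow> complex ^ 3 \<Rightarrow> complex" where
  "cdot a b = (\<Sum>i\<in>UNIV. a $ i * b $ i)"

text \<open>Membership in H^s: real, zero mean, finite norm.\<close>
definition inH :: "real \<Rightarrow> sfield \<Rightarrow> bool" where
  "inH s f \<longleftrightarrow> f 0 = 0 \<and> (\<forall>k. f (- k) = cnj (f k)) \<and> sobsq s f < \<infinity>"

text \<open>Membership in V^s: real, zero mean, divergence free, finite norm.\<close>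
definition inV :: "real \<Rightarrow> vfield \<Rightarrow> bool" where
  "inV s w \<longleftrightarrow> w 0 = 0 \<and> (\<forall>k. w (- k) = vcnj (w k)) \<and>
     (\<forall>k. cdot (w k) (kvec k) = 0) \<and> sobsq s w < \<infinity>"

definition leray :: "freq \<Rightarrow> complex ^ 3 \<Rightarrow> complex ^ 3" where
  "leray k w = (if k = 0 then 0
     else w - (cdot w (kvec k) / complex_of_real ((knorm k)^2)) *s kvec k)"

text \<open>e_3 (third coordinate; index type 3 = {0,1,2}).\<close>
definition e3 :: "complex ^ 3" where
  "e3 = axis (2::3) 1"

definition velocity :: "real \<Rightarrow> vfield \<Rightarrow> vfield" where
  "velocity \<alpha> v = (\<lambda>k. if k = 0 then 0 else complex_of_real (knorm k powr (- 2 * \<alpha>)) *s v k)"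

text \<open>Fourier coefficients of u.grad(theta) and (u.grad) v (convolutions).\<close>
definition adv_s :: "vfield \<Rightarrow> sfield \<Rightarrow> sfield" where
  "adv_s u \<theta> k = infsum (\<lambda>j. cdot (u j) (\<i> *s kvec (k - j)) * \<theta> (k - j)) UNIV"

definition adv_v :: "vfield \<Rightarrow> vfield \<Rightarrow> vfield" where
  "adv_v u v k = infsum (\<lambda>j. cdot (u j) (\<i> *s kvec (k - j)) *s v (k - j)) UNIV"

definition Bop :: "vfield \<Rightarrow> vfield \<Rightarrow> vfield" where
  "Bop u v k = leray k (adv_v u v k)"

definition is_sol :: "real \<Rightarrow> real \<Rightarrow> real \<Rightarrow> real \<Rightarrow> (real \<Rightarrow> vfield) \<Rightarrow> (real \<Rightarrow> sfield)
    \<Rightarrow> vfield \<Rightarrow> sfield \<Rightarrow> bool" where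
  "is_sol \<nu> \<alpha> \<beta> T v \<theta> v0 \<theta>0 \<longleftrightarrow>
     (\<forall>t\<in>{0..T}. \<forall>k. k \<noteq> 0 \<longrightarrow>
        ((\<lambda>s. - Bop (velocity \<alpha> (v s)) (v s) k
              - complex_of_real (\<nu> * knorm k powr (2 * \<beta>)) *s v s k
              + leray k (\<theta> s k *s e3))
          has_integral (v t k - v0 k)) {0..t}) \<and>
     (\<forall>t\<in>{0..T}. \<forall>k. k \<noteq> 0 \<longrightarrow>
        ((\<lambda>s. - adv_s (velocity \<alpha> (v s)) (\<theta> s) k) has_integral (\<theta> t k - \<theta>0 k)) {0..t})"

definition cont_in :: "real \<Rightarrow> (real \<Rightarrow> freq \<Rightarrow> 'a::real_normed_vector) \<Rightarrow> real \<Rightarrow> bool" where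
  "cont_in s f T \<longleftrightarrow>
     (\<forall>t\<in>{0..T}. ((\<lambda>\<tau>. sobnorm s (f \<tau> - f t)) \<longlongrightarrow> 0) (at t within {0..T}))"

definition L2fin :: "real \<Rightarrow> (real \<Rightarrow> freq \<Rightarrow> 'a::real_normed_vector) \<Rightarrow> real \<Rightarrow> bool" where
  "L2fin s f T \<longleftrightarrow> (\<integral>\<^sup>+ t\<in>{0..T}. sobsq s (f t) \<partial>lborel) < \<infinity>"

definition L2norm :: "real \<Rightarrow> (real \<Rightarrow> freq \<Rightarrow> 'a::real_normed_vector) \<Rightarrow> real \<Rightarrow> real" where
  "L2norm s f T = sqrt (enn2real (\<integral>\<^sup>+ t\<in>{0..T}. sobsq s (f t) \<partial>lborel))"

definition Linfnorm :: "real \<Rightarrow> (real \<Rightarrow> freq \<Rightarrow> 'a::real_normed_vector) \<Rightarrow> real \<Rightarrow> real" where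
  "Linfnorm s f T = (SUP t\<in>{0..T}. sobnorm s (f t))"

end

theory Submission
  imports Defs
begin

text \<open>The differences \<open>w = v1 - v2\<close> and \<open>\<eta> = \<theta>1 - \<theta>2\<close> are controlled through the energy
  \<open>\<parallel>w\<parallel>\<^sup>2 + \<parallel>\<eta>\<parallel>\<^sup>2\<close> in \<open>V\<close> and \<open>H\<close> of orders \<open>s = r - 1\<close> and \<open>\<sigma> = r - \<beta> - 1\<close>.
  On the Fourier side every transport term is a trilinear sum over \<open>k\<close> and \<open>j\<close> with weight
  \<open>\<bar>k\<bar> powr s * \<bar>k - j\<bar>\<close>. Since \<open>\<bar>k\<bar>\<close> is at most twice the larger of \<open>\<bar>j\<bar>\<close> and \<open>\<bar>k - j\<bar>\<close>, the smaller
  frequency can be made to carry a factor whose power \<open>- p\<close> with \<open>p > 3/2\<close> is square summable over the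
  lattice, and Young's inequality applies; the velocity gains the order \<open>p = s + 2 * \<alpha>\<close>, which exceeds
  \<open>s\<close>, \<open>\<sigma>\<close> and \<open>3/2\<close> in the whole parameter range. Transport of the differences themselves
  would lose a derivative, but the weights at \<open>k\<close> and \<open>k - j\<close> enter antisymmetrically. The buoyancy term
  is absorbed by the dissipation because \<open>2 * s = (s + \<beta>) + \<sigma>\<close>. The energy inequality holds for finite
  Fourier truncations, where every mode is continuously differentiable in time; dominated
  convergence and Gronwall's lemma finish the proof.\<close>

section \<open>Wave vectors\<close>

text \<open>Differences are measured one order below the solutions because, once the equations are
  subtracted, the velocity difference transports a solution itself, and the gradient of
  \<open>v1\<close> or \<open>\<theta>1\<close> uses up its last derivative. The velocity of
  \<open>w\<close> in order \<open>p\<close> is exactly as large as \<open>w\<close> in order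
  \<open>s\<close>, so this term is closed by the energy. The condition r > \<beta> + 2 says that
  \<sigma> > 1, which leaves room for the order \<sigma> - 1 in which the temperature commutator is
  estimated. The obstacle is that cancellation and truncation do not fit together: modes are
  differentiated finitely many at a time, but the involution behind the cancellation moves
  \<open>k\<close> to \<open>k - j\<close>, possibly out of any finite box. The truncated flux is
  therefore bounded only crudely, through norms of order \<open>s + 1\<close> and
  \<open>\<sigma> + 1\<close>. That bound serves for domination, and the commutator estimate is
  applied to the limit of the flux. Gronwall's lemma is then needed for an integral inequality
  between functions known only to be integrable.\<close>

lemma norm_kvec: "norm (kvec k) = knorm k"
  by (simp add: norm_vec_def L2_set_def kvec_def knorm_def)

lemma kvec_add: "kvec (j + k) = kvec j + kvec k"
  by (simp add: kvec_def vec_eq_iff)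

lemma kvec_diff: "kvec (j - k) = kvec j - kvec k"
  by (simp add: kvec_def vec_eq_iff)

lemma knorm_nonneg [simp]: "0 \<le> knorm k"
  by (simp add: knorm_def sum_nonneg)

lemma knorm_zero [simp]: "knorm 0 = 0"
  by (simp add: knorm_def)

lemma knorm_minus [simp]: "knorm (- k) = knorm k"
  by (simp add: knorm_def)

lemma knorm_triangle: "knorm (j + k) \<le> knorm j + knorm k"
  unfolding norm_kvec[symmetric] kvec_add by (rule norm_triangle_ineq)

lemma knorm_ge_1: "k \<noteq> 0 \<Longrightarrow> 1 \<le> knorm k"
proof -
  assume "k \<noteq> 0"
  then obtain i where i: "k $ i \<noteq> 0" by (auto simp: vec_eq_iff)
  have "1 \<le> (real_of_int (k $ i))\<^sup>2"
  proof -
    have "1 \<le> \<bar>k $ i\<bar>" using i by simp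
    then have "1 \<le> \<bar>real_of_int (k $ i)\<bar>" by linarith
    then show ?thesis using abs_le_square_iff[of 1 "real_of_int (k $ i)"] by simp
  qed
  also have "\<dots> \<le> (\<Sum>i\<in>UNIV. (real_of_int (k $ i))^2)"
    by (rule member_le_sum) auto
  finally show ?thesis unfolding knorm_def by simp
qed

lemma knorm_pos: "k \<noteq> 0 \<Longrightarrow> 0 < knorm k"
  using knorm_ge_1[of k] by linarith

lemma knorm_eq_0_iff [simp]: "knorm k = 0 \<longleftrightarrow> k = 0"
proof
  show "k = 0" if "knorm k = 0" using knorm_pos[of k] that by (cases "k = 0") auto
qed simp

lemma abs_knorm_diff_le: "\<bar>knorm k - knorm (k - j)\<bar> \<le> knorm j"
  using knorm_triangle[of "k - j" j] knorm_triangle[of k "- j"] by (simp add: abs_le_iff)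

lemma norm_cdot_le: "norm (cdot a b) \<le> norm a * norm b"
proof -
  have "norm (cdot a b) \<le> (\<Sum>i\<in>UNIV. \<bar>norm (a $ i)\<bar> * \<bar>norm (b $ i)\<bar>)"
    unfolding cdot_def by (rule order_trans[OF norm_sum]) (simp add: norm_mult)
  also have "\<dots> \<le> norm a * norm b"
    unfolding norm_vec_def by (rule L2_set_mult_ineq)
  finally show ?thesis .
qed

lemma norm_vector_smult: "norm (c *s (w :: complex ^ 3)) = norm c * norm w"
  by (simp add: norm_vec_def norm_mult L2_set_right_distrib)

section \<open>Square-summable families\<close>

text \<open>Square summability with norm at most \<open>B\<close>, encoded through finite sets
  alone, so that the inequalities for \<open>L2_set\<close> apply directly and no convergence has to
  be discussed. Lattice weights and Sobolev norms are both handled in this form.\<close>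

definition l2_bounded :: "real \<Rightarrow> ('i \<Rightarrow> real) \<Rightarrow> bool" where
  "l2_bounded B f \<longleftrightarrow> (\<forall>F. finite F \<longrightarrow> L2_set f F \<le> B)"

text \<open>Since \<open>0 powr s = 0\<close> for every \<open>s\<close>, the zero mode never contributes, not even for \<open>s = 0\<close>.\<close>

definition weighted :: "real \<Rightarrow> (freq \<Rightarrow> 'a::real_normed_vector) \<Rightarrow> freq \<Rightarrow> real" where
  "weighted s f k = knorm k powr s * norm (f k)"

lemma l2_boundedD: "l2_bounded B f \<Longrightarrow> finite F \<Longrightarrow> L2_set f F \<le> B"
  by (simp add: l2_bounded_def)

lemma l2_bounded_nonneg: "l2_bounded B f \<Longrightarrow> 0 \<le> B"
  using l2_boundedD[of B f "{}"] by simp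

lemma l2_bounded_mono:
  assumes "l2_bounded B f" "\<And>k. 0 \<le> g k" "\<And>k. g k \<le> f k"
  shows "l2_bounded B g"
  unfolding l2_bounded_def
proof (intro allI impI)
  fix F :: "'a set" assume "finite F"
  then show "L2_set g F \<le> B"
    using l2_boundedD[OF assms(1)] L2_set_mono[of F g f] assms(2,3) order_trans by blast
qed

lemma l2_bounded_add:
  assumes "l2_bounded A f" "l2_bounded B g"
  shows "l2_bounded (A + B) (\<lambda>k. f k + g k)"
  unfolding l2_bounded_def
proof (intro allI impI)
  fix F :: "'a set" assume "finite F"
  then show "L2_set (\<lambda>k. f k + g k) F \<le> A + B"
    using L2_set_triangle_ineq[of f g F] l2_boundedD[OF assms(1)] l2_boundedD[OF assms(2)]
    by (meson add_mono order_trans)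
qed

lemma weighted_nonneg [simp]: "0 \<le> weighted s f k"
  by (simp add: weighted_def)

lemma weighted_0 [simp]: "weighted s f 0 = 0"
  by (simp add: weighted_def)

lemma weighted_square: "(weighted s f k)\<^sup>2 = knorm k powr (2 * s) * (norm (f k))\<^sup>2"
proof -
  have "(knorm k powr s)\<^sup>2 = knorm k powr (2 * s)"
    by (simp add: power2_eq_square flip: powr_add)
  then show ?thesis by (simp add: weighted_def power_mult_distrib)
qed

lemma sobsq_ge_sum:
  assumes "finite F"
  shows "ennreal (\<Sum>k\<in>F. (weighted s f k)\<^sup>2) \<le> sobsq s f"
proof -
  have "ennreal (\<Sum>k\<in>F. (weighted s f k)\<^sup>2) = ennreal (\<Sum>k\<in>F - {0}. (weighted s f k)\<^sup>2)"
    using assms by (intro arg_cong[where f=ennreal] sum.mono_neutral_right) auto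
  also have "\<dots> = (\<Sum>k\<in>F - {0}. ennreal ((weighted s f k)\<^sup>2))"
    by (simp add: sum_ennreal)
  also have "\<dots> = (\<integral>\<^sup>+ k. ennreal ((weighted s f k)\<^sup>2) \<partial>count_space (F - {0}))"
    using assms by (simp add: nn_integral_count_space_finite)
  also have "\<dots> \<le> (\<integral>\<^sup>+ k. ennreal ((weighted s f k)\<^sup>2) \<partial>count_space (UNIV - {0}))"
    by (simp add: nn_integral_count_space_indicator)
       (intro nn_integral_mono, auto simp: indicator_def)
  also have "\<dots> = sobsq s f"
    unfolding sobsq_def weighted_square by (simp add: mult.commute)
  finally show ?thesis .
qed

section \<open>Exhaustion of the nonzero lattice by finite boxes\<close>

definition freq_box :: "nat \<Rightarrow> freq set" where
  "freq_box N = {k. k \<noteq> 0 \<and> (\<forall>i. \<bar>k $ i\<bar> \<le> int N)}"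

lemma finite_int_cube: "finite {k :: freq. \<forall>i. \<bar>k $ i\<bar> \<le> N}"
proof (rule inj_on_finite)
  show "inj_on (\<lambda>k :: freq. (k $ 1, k $ 2, k $ 3)) {k. \<forall>i. \<bar>k $ i\<bar> \<le> N}"
    by (auto simp: inj_on_def vec_eq_iff forall_3)
  show "(\<lambda>k :: freq. (k $ 1, k $ 2, k $ 3)) ` {k. \<forall>i. \<bar>k $ i\<bar> \<le> N}
      \<subseteq> {- N..N} \<times> {- N..N} \<times> {- N..N}"
    by (auto simp: abs_le_iff forall_3)
qed auto

lemma finite_freq_box [simp]: "finite (freq_box N)"
  unfolding freq_box_def by (rule finite_subset[OF _ finite_int_cube[of "int N"]]) auto

lemma zero_notin_freq_box [simp]: "0 \<notin> freq_box N"
  by (simp add: freq_box_def)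

lemma freq_box_mono: "M \<le> N \<Longrightarrow> freq_box M \<subseteq> freq_box N"
  unfolding freq_box_def by (auto intro: order_trans)

lemma mem_freq_box: "k \<noteq> 0 \<Longrightarrow> k \<in> freq_box (nat (\<Sum>i\<in>UNIV. \<bar>k $ i\<bar>))"
  by (auto simp: freq_box_def sum_nonneg intro: member_le_sum)

lemma finite_subset_freq_box:
  assumes "finite F"
  obtains N where "F - {0} \<subseteq> freq_box N"
proof -
  define N where "N = (\<lambda>k :: freq. nat (\<Sum>i\<in>UNIV. \<bar>k $ i\<bar>))"
  have "F - {0} \<subseteq> freq_box (Max (N ` F))"
  proof
    fix k assume k: "k \<in> F - {0}"
    then have "N k \<le> Max (N ` F)" using assms by auto
    then show "k \<in> freq_box (Max (N ` F))"
      using mem_freq_box[of k] freq_box_mono[of "N k"] k unfolding N_def by auto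
  qed
  then show ?thesis using that by blast
qed

text \<open>Boxes are cofinal among the finite sets of nonzero wave vectors, so an unconditional sum
  over these vectors is also a limit along a sequence. A sequence is what the convergence theorems
  for time integrals require.\<close>

lemma filterlim_freq_box:
  "filterlim freq_box (finite_subsets_at_top (UNIV - {0})) sequentially"
  unfolding filterlim_finite_subsets_at_top
proof (intro allI impI)
  fix X :: "freq set" assume X: "finite X \<and> X \<subseteq> UNIV - {0}"
  then obtain N where "X - {0} \<subseteq> freq_box N" using finite_subset_freq_box by blast
  then have "X \<subseteq> freq_box N" using X by auto
  then show "\<forall>\<^sub>F n in sequentially. finite (freq_box n) \<and> X \<subseteq> freq_box n \<and> freq_box n \<subseteq> UNIV - {0}"
    using freq_box_mono by (intro eventually_sequentiallyI[of N]) auto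
qed

text \<open>Monotone convergence for counting measure. As a supremum over a sequence of finite sums,
  the norm can later be exchanged with a time integral.\<close>

lemma sobsq_eq_SUP: "sobsq s f = (SUP N. ennreal (\<Sum>k\<in>freq_box N. (weighted s f k)\<^sup>2))"
proof -
  let ?g = "\<lambda>N k. ennreal ((weighted s f k)\<^sup>2) * indicator (freq_box N) k"
  have "sobsq s f = (\<integral>\<^sup>+ k. ennreal ((weighted s f k)\<^sup>2) \<partial>count_space (UNIV - {0}))"
    unfolding sobsq_def weighted_square by (simp add: mult.commute)
  also have "\<dots> = (\<integral>\<^sup>+ k. ennreal ((weighted s f k)\<^sup>2) * indicator (UNIV - {0}) k \<partial>count_space UNIV)"
    by (simp add: nn_integral_count_space_indicator)
  also have "\<dots> = (\<integral>\<^sup>+ k. (SUP N. ?g N k) \<partial>count_space UNIV)"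
  proof (rule nn_integral_cong)
    fix k :: freq
    show "ennreal ((weighted s f k)\<^sup>2) * indicator (UNIV - {0}) k = (SUP N. ?g N k)"
    proof (cases "k = 0")
      case False
      have "(SUP N. ?g N k) = ennreal ((weighted s f k)\<^sup>2)"
      proof (rule SUP_eqI)
        fix y assume "\<And>N. N \<in> UNIV \<Longrightarrow> ?g N k \<le> y"
        from this[of "nat (\<Sum>i\<in>UNIV. \<bar>k $ i\<bar>)"] show "ennreal ((weighted s f k)\<^sup>2) \<le> y"
          using mem_freq_box[OF False] by (simp add: indicator_def)
      qed (simp add: indicator_def)
      then show ?thesis using False by simp
    qed (simp add: freq_box_def)
  qed
  also have "\<dots> = (SUP N. \<integral>\<^sup>+ k. ?g N k \<partial>count_space UNIV)"
    by (rule nn_integral_monotone_convergence_SUP)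
       (use freq_box_mono in \<open>auto simp: incseq_def le_fun_def indicator_def\<close>)
  also have "\<dots> = (SUP N. ennreal (\<Sum>k\<in>freq_box N. (weighted s f k)\<^sup>2))"
    by (simp add: nn_integral_count_space_finite sum_ennreal
        flip: nn_integral_count_space_indicator)
  finally show ?thesis .
qed

lemma sobsq_leI:
  assumes "\<And>N. (\<Sum>k\<in>freq_box N. (weighted s f k)\<^sup>2) \<le> B"
  shows "sobsq s f \<le> ennreal B"
  unfolding sobsq_eq_SUP by (intro SUP_least ennreal_leI assms)

section \<open>Sobolev norms as square-sum bounds\<close>

lemma l2_bounded_sobnorm:
  assumes "sobsq s f < \<infinity>"
  shows "l2_bounded (sobnorm s f) (weighted s f)"
  unfolding l2_bounded_def
proof (intro allI impI)
  fix F :: "freq set" assume "finite F"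
  then have "ennreal (\<Sum>k\<in>F. (weighted s f k)\<^sup>2) \<le> ennreal (enn2real (sobsq s f))"
    using sobsq_ge_sum[of F s f] assms by simp
  then show "L2_set (weighted s f) F \<le> sobnorm s f"
    unfolding sobnorm_def L2_set_def by (simp add: ennreal_le_iff)
qed

text \<open>Converse of \<open>l2_bounded_sobnorm\<close>: the Sobolev norm is the least such bound,
  so inequalities between norms follow from pointwise inequalities between weighted
  coefficients.\<close>

lemma l2_bounded_imp_sobolev:
  assumes "l2_bounded B (weighted s f)"
  shows "sobsq s f < \<infinity>" and "sobnorm s f \<le> B"
proof -
  have B: "0 \<le> B" by (rule l2_bounded_nonneg[OF assms])
  have le: "sobsq s f \<le> ennreal (B\<^sup>2)"
  proof (rule sobsq_leI)
    fix N
    have "L2_set (weighted s f) (freq_box N) \<le> B"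
      by (rule l2_boundedD[OF assms]) simp
    then show "(\<Sum>k\<in>freq_box N. (weighted s f k)\<^sup>2) \<le> B\<^sup>2"
      unfolding L2_set_def by (meson B sqrt_le_D)
  qed
  then show fin: "sobsq s f < \<infinity>" 
    by (simp add: le_less_trans[OF _ ennreal_less_top])
  have "enn2real (sobsq s f) \<le> B\<^sup>2" using le by (simp add: enn2real_leI)
  then show "sobnorm s f \<le> B" unfolding sobnorm_def using B by (simp add: real_le_lsqrt)
qed

lemma sobnorm_nonneg [simp]: "0 \<le> sobnorm s f"
  by (simp add: sobnorm_def)

lemma sobsq_eq_sobnorm: "sobsq s f < \<infinity> \<Longrightarrow> sobsq s f = ennreal ((sobnorm s f)\<^sup>2)"
  by (simp add: sobnorm_def)

lemma
  assumes "sobsq t g < \<infinity>" and "\<And>k. weighted s f k \<le> weighted t g k"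
  shows sobsq_finite_compare: "sobsq s f < \<infinity>" and sobnorm_compare: "sobnorm s f \<le> sobnorm t g"
  using l2_bounded_imp_sobolev[OF l2_bounded_mono[OF l2_bounded_sobnorm[OF assms(1)] weighted_nonneg assms(2)]]
  by auto

lemma weighted_le_weighted:
  assumes "s \<le> t" shows "weighted s f k \<le> weighted t f k"
proof (cases "k = 0")
  case False
  then show ?thesis unfolding weighted_def
    using knorm_ge_1[of k] assms by (intro mult_right_mono powr_mono) auto
qed simp

lemmas sobsq_finite_mono = sobsq_finite_compare[OF _ weighted_le_weighted]
lemmas sobnorm_mono = sobnorm_compare[OF _ weighted_le_weighted]

lemma
  assumes "sobsq s f < \<infinity>" "sobsq s g < \<infinity>"
  shows sobsq_finite_add: "sobsq s (\<lambda>k. f k + g k) < \<infinity>"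
    and sobnorm_triangle: "sobnorm s (\<lambda>k. f k + g k) \<le> sobnorm s f + sobnorm s g"
proof -
  have "l2_bounded (sobnorm s f + sobnorm s g) (weighted s (\<lambda>k. f k + g k))"
    by (rule l2_bounded_mono[OF l2_bounded_add[OF assms[THEN l2_bounded_sobnorm]]])
      (auto simp: weighted_def norm_triangle_ineq mult_left_mono simp flip: distrib_left)
  from l2_bounded_imp_sobolev[OF this]
  show "sobsq s (\<lambda>k. f k + g k) < \<infinity>"
    "sobnorm s (\<lambda>k. f k + g k) \<le> sobnorm s f + sobnorm s g" by auto
qed

lemma weighted_uminus [simp]: "weighted s (- f) = weighted s f"
  by (simp add: weighted_def fun_eq_iff)

lemma sobsq_uminus [simp]: "sobsq s (- f) = sobsq s f"
  by (simp add: sobsq_eq_SUP)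

lemma sobnorm_uminus [simp]: "sobnorm s (- f) = sobnorm s f"
  by (simp add: sobnorm_def)

lemma sobsq_finite_diff:
  "sobsq s f < \<infinity> \<Longrightarrow> sobsq s g < \<infinity> \<Longrightarrow> sobsq s (f - g) < \<infinity>"
  using sobsq_finite_add[of s f "- g"] by (simp add: fun_diff_def)

lemma sobnorm_diff_le:
  assumes "sobsq q f < \<infinity>" "sobsq q g < \<infinity>"
  shows "sobnorm q (f - g) \<le> sobnorm q f + sobnorm q g"
  using sobnorm_triangle[of q f "- g"] assms by (simp add: fun_diff_def)

lemma abs_sobnorm_diff_le:
  assumes "sobsq s f < \<infinity>" "sobsq s g < \<infinity>"
  shows "\<bar>sobnorm s f - sobnorm s g\<bar> \<le> sobnorm s (f - g)"
proof -
  have "sobnorm s (g - f) = sobnorm s (f - g)"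
    by (simp add: sobnorm_def sobsq_def norm_minus_commute)
  then show ?thesis
    using sobnorm_triangle[OF sobsq_finite_diff[OF assms] assms(2)]
      sobnorm_triangle[OF sobsq_finite_diff[OF assms(2,1)] assms(1)] by (simp add: fun_diff_def)
qed

lemma weighted_square_sum_tendsto:
  assumes "sobsq s f < \<infinity>"
  shows "(\<lambda>N. \<Sum>k\<in>freq_box N. (weighted s f k)\<^sup>2) \<longlonglongrightarrow> (sobnorm s f)\<^sup>2"
proof -
  have "(\<lambda>N. ennreal (\<Sum>k\<in>freq_box N. (weighted s f k)\<^sup>2)) \<longlonglongrightarrow> sobsq s f"
    unfolding sobsq_eq_SUP
    by (intro LIMSEQ_SUP) (auto simp: incseq_def intro!: ennreal_leI sum_mono2 dest: freq_box_mono)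
  then have "(\<lambda>N. ennreal (\<Sum>k\<in>freq_box N. (weighted s f k)\<^sup>2)) \<longlonglongrightarrow> ennreal ((sobnorm s f)\<^sup>2)"
    by (simp add: sobsq_eq_sobnorm[OF assms])
  then show ?thesis
    by (subst (asm) tendsto_ennreal_iff) (auto intro!: always_eventually sum_nonneg)
qed

section \<open>Lattice sums and convolution inequalities\<close>

text \<open>The squared lattice weight will be split into three equal powers, one per coordinate.
  Each decays like n to the power -2p/3, which is summable precisely when p > 3/2.\<close>

lemma summable_int_powr:
  assumes "p > 3/2"
  shows "summable (\<lambda>n::nat. (1 + (real n)\<^sup>2) powr (- p / 3))"
proof (rule summable_comparison_test')
  show "summable (\<lambda>n::nat. real n powr (- 2 * p / 3))"
    using assms by (simp add: summable_real_powr_iff)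
  fix n :: nat assume "1 \<le> n"
  then have "(1 + (real n)\<^sup>2) powr (- p / 3) \<le> ((real n)\<^sup>2) powr (- p / 3)"
    using assms by (intro powr_mono2') auto
  also have "\<dots> = real n powr (- 2 * p / 3)"
    using \<open>1 \<le> n\<close> by (simp add: powr_powr flip: powr_numeral)
  finally show "norm ((1 + (real n)\<^sup>2) powr (- p / 3)) \<le> real n powr (- 2 * p / 3)" by simp
qed

lemma bounded_int_powr_sums:
  assumes "p > 3/2"
  obtains C where "\<And>N::nat. (\<Sum>n\<in>{- int N..int N}. (1 + (real_of_int n)\<^sup>2) powr (- p / 3)) \<le> C"
proof
  let ?c = "\<lambda>x::real. (1 + x\<^sup>2) powr (- p / 3)"
  fix N :: nat
  have pos: "(\<Sum>n\<in>{0..int N}. ?c (real_of_int n)) = (\<Sum>n\<in>{..N}. ?c (real n))"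
    by (rule sum.reindex_bij_witness[of _ int nat]) auto
  have neg: "(\<Sum>n\<in>{- int N..0}. ?c (real_of_int n)) = (\<Sum>n\<in>{..N}. ?c (real n))"
    by (rule sum.reindex_bij_witness[of _ "\<lambda>n. - int n" "\<lambda>n. nat (- n)"]) auto
  have "{- int N..int N} = {- int N..0} \<union> {0..int N}" by auto
  then have "(\<Sum>n\<in>{- int N..int N}. ?c (real_of_int n)) \<le>
      (\<Sum>n\<in>{- int N..0}. ?c (real_of_int n)) + (\<Sum>n\<in>{0..int N}. ?c (real_of_int n))"
    by (simp add: sum_nonneg flip: sum.union_inter)
  also have "\<dots> = 2 * (\<Sum>n\<in>{..N}. ?c (real n))" using pos neg by simp
  also have "\<dots> \<le> 2 * (\<Sum>n. ?c (real n))"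
    using summable_int_powr[OF assms] by (intro mult_left_mono sum_le_suminf) auto
  finally show "(\<Sum>n\<in>{- int N..int N}. ?c (real_of_int n)) \<le> 2 * (\<Sum>n. ?c (real n))" .
qed

text \<open>As \<open>knorm k\<close> is at least 1, twice its square dominates 1 plus the square of
  each coordinate; a third of the power is spent on each coordinate and \<open>2 powr p\<close> pays
  for the doubling. In this product form the lattice sum factorizes into one-dimensional
  sums.\<close>

lemma knorm_powr_le_prod:
  assumes "k \<noteq> 0" "p > 0"
  shows "(knorm k powr - p)\<^sup>2 \<le> 2 powr p * ((1 + (real_of_int (k $ 1))\<^sup>2) powr (- p / 3) *
    ((1 + (real_of_int (k $ 2))\<^sup>2) powr (- p / 3) * (1 + (real_of_int (k $ 3))\<^sup>2) powr (- p / 3)))"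
proof -
  let ?K = "2 * (knorm k)\<^sup>2"
  have K: "1 \<le> (knorm k)\<^sup>2" using knorm_ge_1[OF assms(1)] by (simp add: one_le_power)
  have kpos: "0 < knorm k" using knorm_pos[OF assms(1)] .
  have c: "?K powr (- p / 3) \<le> (1 + (real_of_int (k $ i))\<^sup>2) powr (- p / 3)" for i
  proof (rule powr_mono2')
    have "(real_of_int (k $ i))\<^sup>2 \<le> (\<Sum>i\<in>UNIV. (real_of_int (k $ i))\<^sup>2)"
      by (rule member_le_sum) auto
    also have "\<dots> = (knorm k)\<^sup>2" by (simp add: knorm_def sum_nonneg)
    finally show "1 + (real_of_int (k $ i))\<^sup>2 \<le> ?K" using K by linarith
    show "0 < 1 + (real_of_int (k $ i))\<^sup>2" by (simp add: add_pos_nonneg)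
  qed (use assms in auto)
  have "(knorm k powr - p)\<^sup>2 = ((knorm k)\<^sup>2) powr (- p)"
    using kpos by (simp add: power2_eq_square powr_mult)
  also have "\<dots> = 2 powr p * ?K powr (- p)"
    using kpos by (simp add: powr_mult powr_minus)
  also have "?K powr (- p) = ?K powr (- p / 3) * (?K powr (- p / 3) * ?K powr (- p / 3))"
    by (simp flip: powr_add)
  also have "2 powr p * \<dots> \<le> 2 powr p * ((1 + (real_of_int (k $ 1))\<^sup>2) powr (- p / 3) *
    ((1 + (real_of_int (k $ 2))\<^sup>2) powr (- p / 3) * (1 + (real_of_int (k $ 3))\<^sup>2) powr (- p / 3)))"
    by (intro mult_left_mono mult_mono c) auto
  finally show ?thesis .
qed

lemma l2_bounded_knorm_powr:
  assumes "p > 3/2"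
  obtains S where "l2_bounded S (\<lambda>k. knorm k powr - p)"
proof -
  define c where "c = (\<lambda>n::int. (1 + (real_of_int n)\<^sup>2) powr (- p / 3))"
  obtain C where C: "\<And>N::nat. sum c {- int N..int N} \<le> C"
    using bounded_int_powr_sums[OF assms] unfolding c_def by metis
  have c0: "0 \<le> c n" for n by (simp add: c_def)
  have C0: "0 \<le> C" using C[of 0] c0[of 0] by simp
  have "l2_bounded (sqrt (2 powr p * (C * (C * C)))) (\<lambda>k. knorm k powr - p)"
    unfolding l2_bounded_def L2_set_def
  proof (intro allI impI real_sqrt_le_mono)
    fix F :: "freq set" assume F: "finite F"
    obtain N where N: "F - {0} \<subseteq> freq_box N" using finite_subset_freq_box[OF F] .
    let ?J = "{- int N..int N}" and ?t = "\<lambda>k :: freq. (k $ 1, k $ 2, k $ 3)"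
    let ?d = "\<lambda>(x, y, z). c x * (c y * c z)"
    have inj: "inj_on ?t (freq_box N)" by (auto simp: inj_on_def vec_eq_iff forall_3)
    have "(\<Sum>k\<in>F. (knorm k powr - p)\<^sup>2) = (\<Sum>k\<in>F - {0}. (knorm k powr - p)\<^sup>2)"
      using F by (intro sum.mono_neutral_right) auto
    also have "\<dots> \<le> (\<Sum>k\<in>freq_box N. (knorm k powr - p)\<^sup>2)"
      by (rule sum_mono2) (use N in auto)
    also have "\<dots> \<le> (\<Sum>k\<in>freq_box N. 2 powr p * ?d (?t k))"
    proof (rule sum_mono)
      fix k assume "k \<in> freq_box N"
      then have "k \<noteq> 0" by (auto simp: freq_box_def)
      then show "(knorm k powr - p)\<^sup>2 \<le> 2 powr p * ?d (?t k)"
        using knorm_powr_le_prod[of k p] assms by (simp add: c_def)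
    qed
    also have "\<dots> = 2 powr p * sum ?d (?t ` freq_box N)"
      by (simp add: sum_distrib_left sum.reindex[OF inj])
    also have "\<dots> \<le> 2 powr p * sum ?d (?J \<times> ?J \<times> ?J)"
    proof (intro mult_left_mono sum_mono2)
      have "k $ i \<le> int N \<and> - int N \<le> k $ i" if "k \<in> freq_box N" for k i
        using that by (auto simp: freq_box_def abs_le_iff minus_le_iff)
      then show "?t ` freq_box N \<subseteq> ?J \<times> ?J \<times> ?J" by auto
    qed (auto simp: c0)
    also have "sum ?d (?J \<times> ?J \<times> ?J) = sum c ?J * (sum c ?J * sum c ?J)"
      by (simp add: sum.cartesian_product[symmetric] flip: sum_distrib_left sum_distrib_right)
    also have "2 powr p * \<dots> \<le> 2 powr p * (C * (C * C))"
      by (intro mult_left_mono mult_mono C) (auto intro!: mult_nonneg_nonneg sum_nonneg c0 C0)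
    finally show "(\<Sum>k\<in>F. (knorm k powr - p)\<^sup>2) \<le> 2 powr p * (C * (C * C))" .
  qed
  then show ?thesis by (rule that)
qed

text \<open>Young's inequality in dual form: \<open>a\<close> is in l^1, \<open>b\<close> and
  \<open>h\<close> are in l^2. For fixed \<open>j\<close> Cauchy-Schwarz applies, because a
  translation by \<open>j\<close> preserves square sums of \<open>b\<close> over the
  lattice.\<close>

lemma convolution_sum_le:
  fixes a b h :: "freq \<Rightarrow> real"
  assumes "\<And>k. 0 \<le> a k" "\<And>k. 0 \<le> b k" "\<And>k. 0 \<le> h k"
    and A: "\<And>F. finite F \<Longrightarrow> sum a F \<le> A" and B: "l2_bounded B b" and H: "l2_bounded H h"
    and F: "finite F"
  shows "(\<Sum>(k, j)\<in>F. a j * b (k - j) * h k) \<le> A * B * H"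
proof -
  have BH: "0 \<le> B" "0 \<le> H" using B H by (auto intro: l2_bounded_nonneg)
  let ?K = "fst ` F" and ?J = "snd ` F"
  have inner: "(\<Sum>k\<in>?K. b (k - j) * h k) \<le> B * H" for j
  proof -
    have "(\<Sum>k\<in>?K. b (k - j) * h k) = (\<Sum>k\<in>?K. \<bar>b (k - j)\<bar> * \<bar>h k\<bar>)"
      using assms(2,3) by simp
    also have "\<dots> \<le> L2_set (\<lambda>k. b (k - j)) ?K * L2_set h ?K" by (rule L2_set_mult_ineq)
    also have "L2_set (\<lambda>k. b (k - j)) ?K = L2_set b ((\<lambda>k. k - j) ` ?K)"
      unfolding L2_set_def by (subst sum.reindex) (auto simp: inj_on_def)
    also have "\<dots> * L2_set h ?K \<le> B * H"
      using F BH by (intro mult_mono l2_boundedD[OF B] l2_boundedD[OF H]) (auto simp: L2_set_nonneg)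
    finally show ?thesis .
  qed
  \<comment> \<open>Enlarging \<open>F\<close> to a rectangle only adds nonnegative terms and makes
    iterated summation available.\<close>
  have "(\<Sum>(k, j)\<in>F. a j * b (k - j) * h k) \<le> (\<Sum>(k, j)\<in>?K \<times> ?J. a j * b (k - j) * h k)"
    by (rule sum_mono2) (use F assms(1-3) in \<open>auto intro: rev_image_eqI\<close>)
  also have "\<dots> = (\<Sum>j\<in>?J. \<Sum>k\<in>?K. a j * b (k - j) * h k)"
    by (subst sum.swap) (simp add: sum.cartesian_product)
  also have "\<dots> = (\<Sum>j\<in>?J. a j * (\<Sum>k\<in>?K. b (k - j) * h k))"
    by (simp add: sum_distrib_left mult.assoc)
  also have "\<dots> \<le> (\<Sum>j\<in>?J. a j * (B * H))"
    by (intro sum_mono mult_left_mono inner assms(1))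
  also have "\<dots> = sum a ?J * (B * H)" by (simp add: sum_distrib_right)
  also have "\<dots> \<le> A * (B * H)" using F BH by (intro mult_right_mono A) auto
  finally show ?thesis by (simp add: mult.assoc)
qed

text \<open>Split by which of \<open>j\<close> and \<open>k - j\<close> is larger. If it is
  \<open>k - j\<close>, its power \<open>- s\<close> absorbs \<open>knorm k powr s\<close>. If it is
  \<open>j\<close>, the factor \<open>knorm j powr (s - p)\<close> remains, and
  \<open>s \<le> p\<close> allows \<open>j\<close> to be replaced by the smaller
  \<open>k - j\<close>. For \<open>j = 0\<close> or \<open>k = j\<close> the left side vanishes,
  because \<open>powr\<close> has value 0 at base 0.\<close>

lemma knorm_powr_product_le:
  assumes "0 \<le> s" "s \<le> p"
  shows "knorm k powr s * knorm j powr - p * knorm (k - j) powr - s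
    \<le> 2 powr s * (knorm j powr - p + knorm (k - j) powr - p)"
proof (cases "j = 0 \<or> k = j")
  case True
  then show ?thesis by auto
next
  case False
  let ?j = "knorm j" and ?m = "knorm (k - j)"
  have pos: "0 < ?j" "0 < ?m" using False by (auto intro: knorm_pos)
  have k: "knorm k \<le> ?j + ?m" using knorm_triangle[of j "k - j"] by simp
  show ?thesis
  proof (cases "?j \<le> ?m")
    case True
    have "knorm k powr s \<le> (2 * ?m) powr s" using k True assms by (intro powr_mono2) auto
    then have "knorm k powr s * ?j powr - p * ?m powr - s \<le> (2 * ?m) powr s * ?j powr - p * ?m powr - s"
      by (intro mult_right_mono) auto
    also have "\<dots> = 2 powr s * ?j powr - p"
      using pos by (simp add: powr_mult powr_minus_divide del: knorm_eq_0_iff)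
    also have "\<dots> \<le> 2 powr s * (?j powr - p + ?m powr - p)" by simp
    finally show ?thesis .
  next
    case jm: False
    have jm': "?m < ?j" using jm by simp
    have "knorm k powr s \<le> (2 * ?j) powr s" using k jm assms by (intro powr_mono2) auto
    then have "knorm k powr s * ?j powr - p * ?m powr - s \<le> (2 * ?j) powr s * ?j powr - p * ?m powr - s"
      by (intro mult_right_mono) auto
    also have "\<dots> = 2 powr s * (?j powr (s - p) * ?m powr - s)"
      using pos(1) by (simp add: powr_mult powr_diff powr_minus_divide)
    also have "\<dots> \<le> 2 powr s * (?m powr (s - p) * ?m powr - s)"
      using pos jm assms by (intro mult_left_mono mult_right_mono powr_mono2') auto
    also have "\<dots> = 2 powr s * ?m powr - p" by (simp flip: powr_add)
    also have "\<dots> \<le> 2 powr s * (?j powr - p + ?m powr - p)" by simp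
    finally show ?thesis .
  qed
qed

text \<open>With \<open>a = weighted p u\<close> and \<open>b = weighted (s + 1) g\<close> the summand equals
  \<open>\<bar>k\<bar> powr s * \<bar>u j\<bar> * \<bar>k - j\<bar> * \<bar>g (k - j)\<bar> * h k\<close>, the form in which the advection term occurs.\<close>

definition conv_const :: "real \<Rightarrow> real \<Rightarrow> real \<Rightarrow> bool" where
  "conv_const s p C \<longleftrightarrow> 0 \<le> C \<and> (\<forall>a b h A B H F.
    (\<forall>k. 0 \<le> a k) \<and> (\<forall>k. 0 \<le> b k) \<and> (\<forall>k. 0 \<le> h k) \<and>
    l2_bounded A a \<and> l2_bounded B b \<and> l2_bounded H h \<and> finite F \<longrightarrow>
    (\<Sum>(k, j)\<in>F. knorm k powr s * knorm j powr - p * knorm (k - j) powr - s * (a j * b (k - j) * h k))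
      \<le> C * A * B * H)"

lemma conv_const_exists:
  assumes "0 \<le> s" "s \<le> p" "3/2 < p"
  obtains C where "conv_const s p C"
proof -
  obtain S where S: "l2_bounded S (\<lambda>k. knorm k powr - p)"
    using l2_bounded_knorm_powr[OF assms(3)] .
  have S0: "0 \<le> S" by (rule l2_bounded_nonneg[OF S])
  show ?thesis
  proof (rule that, unfold conv_const_def, intro conjI allI impI)
    show "0 \<le> 2 powr s * 2 * S" using S0 by simp
    fix a b h :: "freq \<Rightarrow> real" and A B H and F :: "(freq \<times> freq) set"
    assume asm: "(\<forall>k. 0 \<le> a k) \<and> (\<forall>k. 0 \<le> b k) \<and> (\<forall>k. 0 \<le> h k) \<and>
      l2_bounded A a \<and> l2_bounded B b \<and> l2_bounded H h \<and> finite F"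
    then have nn: "\<And>k. 0 \<le> a k" "\<And>k. 0 \<le> b k" "\<And>k. 0 \<le> h k"
      and l2: "l2_bounded A a" "l2_bounded B b" "l2_bounded H h" and F: "finite F"
      by auto
    \<comment> \<open>Cauchy-Schwarz against the square-summable weight turns an l^2 factor into the
      l^1 factor that Young's inequality demands.\<close>
    have l1: "sum (\<lambda>k. knorm k powr - p * c k) G \<le> S * D"
      if "\<And>k. 0 \<le> c k" "l2_bounded D c" "finite G" for c D G
    proof -
      have "sum (\<lambda>k. knorm k powr - p * c k) G = (\<Sum>k\<in>G. \<bar>knorm k powr - p\<bar> * \<bar>c k\<bar>)"
        using that(1) by simp
      also have "\<dots> \<le> L2_set (\<lambda>k. knorm k powr - p) G * L2_set c G" by (rule L2_set_mult_ineq)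
      also have "\<dots> \<le> S * D"
        using S0 that by (intro mult_mono l2_boundedD[OF S] l2_boundedD) (auto simp: L2_set_nonneg)
      finally show ?thesis .
    qed
    have 1: "(\<Sum>(k, j)\<in>F. (knorm j powr - p * a j) * b (k - j) * h k) \<le> S * A * B * H"
      by (rule convolution_sum_le) (use nn l2 F l1 in auto)
    \<comment> \<open>Substituting \<open>k - j\<close> for \<open>j\<close> exchanges the roles of
      \<open>a\<close> and \<open>b\<close>, for the part in which \<open>k - j\<close> carries the
      decaying weight.\<close>
    let ?r = "\<lambda>(k, j). (k, k - j) :: freq \<times> freq"
    have inj: "inj_on ?r F" by (auto simp: inj_on_def)
    have "(\<Sum>(k, j)\<in>F. (knorm (k - j) powr - p * b (k - j)) * a j * h k) =
       (\<Sum>(k, j)\<in>?r ` F. (knorm j powr - p * b j) * a (k - j) * h k)"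
      by (subst sum.reindex[OF inj]) (auto intro!: sum.cong)
    also have "\<dots> \<le> S * B * A * H"
      by (rule convolution_sum_le) (use nn l2 F l1 in auto)
    finally have 2: "(\<Sum>(k, j)\<in>F. (knorm (k - j) powr - p * b (k - j)) * a j * h k) \<le> S * B * A * H" .
    have "(\<Sum>(k, j)\<in>F. knorm k powr s * knorm j powr - p * knorm (k - j) powr - s * (a j * b (k - j) * h k))
      \<le> (\<Sum>(k, j)\<in>F. 2 powr s * (knorm j powr - p + knorm (k - j) powr - p) * (a j * b (k - j) * h k))"
      by (rule sum_mono)
        (use nn in \<open>auto intro!: mult_right_mono knorm_powr_product_le assms mult_nonneg_nonneg\<close>)
    also have "\<dots> = 2 powr s * ((\<Sum>(k, j)\<in>F. (knorm j powr - p * a j) * b (k - j) * h k) +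
       (\<Sum>(k, j)\<in>F. (knorm (k - j) powr - p * b (k - j)) * a j * h k))"
      by (simp add: sum_distrib_left sum.distrib[symmetric] case_prod_beta algebra_simps)
    also have "\<dots> \<le> 2 powr s * (S * A * B * H + S * B * A * H)"
      by (intro mult_left_mono add_mono 1 2) auto
    also have "\<dots> = 2 powr s * 2 * S * A * B * H" by simp
    finally show "(\<Sum>(k, j)\<in>F. knorm k powr s * knorm j powr - p * knorm (k - j) powr - s *
      (a j * b (k - j) * h k)) \<le> 2 powr s * 2 * S * A * B * H" .
  qed
qed

section \<open>The advection term\<close>

lemma summable_of_bounded_sums:
  fixes f :: "'a \<Rightarrow> 'b::banach"
  assumes "\<And>F. finite F \<Longrightarrow> F \<subseteq> A \<Longrightarrow> (\<Sum>x\<in>F. norm (f x)) \<le> M"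
  shows "(\<lambda>x. norm (f x)) summable_on A" and "f summable_on A" and "norm (infsum f A) \<le> M"
proof -
  show abs: "(\<lambda>x. norm (f x)) summable_on A"
    by (rule nonneg_bdd_above_summable_on) (use assms in \<open>auto intro!: bdd_aboveI2[where M=M]\<close>)
  then show "f summable_on A" by (rule abs_summable_summable)
  have "norm (infsum f A) \<le> infsum (\<lambda>x. norm (f x)) A" by (rule norm_infsum_bound[OF abs])
  also have "\<dots> \<le> M" by (rule infsum_le_finite_sums[OF abs]) (use assms in auto)
  finally show "norm (infsum f A) \<le> M" .
qed

text \<open>Fubini for absolutely summable families. The equations contain the sum over
  \<open>j\<close> as an infinite series, whereas the trilinear estimates concern finite sets of
  pairs; this passes from the latter to the former.\<close>

lemma sum_row_sums_le:
  fixes f :: "'a \<times> 'b \<Rightarrow> real"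
  assumes M: "\<And>F. finite F \<Longrightarrow> (\<Sum>x\<in>F. norm (f x)) \<le> M"
    and b: "\<And>x. ((\<lambda>y. f (x, y)) has_sum b x) UNIV" and A: "finite A"
  shows "(\<Sum>x\<in>A. \<bar>b x\<bar>) \<le> M"
proof -
  have abs: "(\<lambda>x. norm (f x)) summable_on A \<times> UNIV" and bnd: "infsum (\<lambda>x. norm (f x)) (A \<times> UNIV) \<le> M"
    using summable_of_bounded_sums[of "A \<times> UNIV" "\<lambda>x. norm (f x)" M] M by auto
  define r where "r x = infsum (\<lambda>y. norm (f (x, y))) UNIV" for x
  have rows: "((\<lambda>y. norm (f (x, y))) has_sum r x) UNIV" if "x \<in> A" for x
  proof -
    have "(\<lambda>(x, y). norm (f (x, y))) summable_on A \<times> UNIV"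
      by (subst summable_on_cong[where g="\<lambda>x. norm (f x)"]) (use abs in auto)
    then show ?thesis
      unfolding r_def using summable_on_SigmaD1 that by (intro has_sum_infsum) fastforce
  qed
  have "(r has_sum infsum (\<lambda>x. norm (f x)) (A \<times> UNIV)) A"
    by (rule has_sum_SigmaD[OF has_sum_infsum[OF abs] rows])
  then have "sum r A = infsum (\<lambda>x. norm (f x)) (A \<times> UNIV)"
    using has_sum_finite_iff[OF A] by metis
  moreover have "\<bar>b x\<bar> \<le> r x" if "x \<in> A" for x
    using norm_infsum_le[OF b rows[OF that]] by simp
  ultimately show ?thesis using sum_mono[of A "\<lambda>x. \<bar>b x\<bar>" r] bnd by simp
qed

lemma conv_const_nonneg: "conv_const s p C \<Longrightarrow> 0 \<le> C"
  by (simp add: conv_const_def)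

lemma conv_constD:
  assumes "conv_const s p C" "\<And>k. 0 \<le> a k" "\<And>k. 0 \<le> b k" "\<And>k. 0 \<le> h k"
    "l2_bounded A a" "l2_bounded B b" "l2_bounded H h" "finite F"
  shows "(\<Sum>(k, j)\<in>F. knorm k powr s * knorm j powr - p * knorm (k - j) powr - s *
    (a j * b (k - j) * h k)) \<le> C * A * B * H"
  using assms unfolding conv_const_def by blast

definition advection_term :: "vfield \<Rightarrow> sfield \<Rightarrow> freq \<Rightarrow> freq \<Rightarrow> complex" where
  "advection_term u g k j = cdot (u j) (\<i> *s kvec (k - j)) * g (k - j)"

lemma adv_s_eq: "adv_s u g k = infsum (advection_term u g k) UNIV"
  by (simp add: adv_s_def advection_term_def[abs_def])

lemma norm_cdot_i_kvec_le: "norm (cdot w (\<i> *s kvec m)) \<le> norm w * knorm m"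
  using norm_cdot_le[of w "\<i> *s kvec m"] by (simp add: norm_vector_smult norm_kvec)

text \<open>Away from zero frequencies the inserted powers cancel against the weights. Otherwise the
  right side is 0, and so is the left: \<open>u 0 = 0\<close> handles \<open>j = 0\<close>, the
  gradient handles \<open>k = j\<close>.\<close>

lemma norm_advection_term_le:
  assumes "u 0 = 0"
  shows "norm (advection_term u g k j)
    \<le> knorm j powr - p * knorm (k - j) powr - s * (weighted p u j * weighted (s + 1) g (k - j))"
proof (cases "j = 0 \<or> k = j")
  case True
  then show ?thesis using assms by (auto simp: advection_term_def cdot_def kvec_def weighted_def)
next
  case False
  then have pos: "0 < knorm j" "0 < knorm (k - j)" by (auto intro: knorm_pos)
  have "norm (advection_term u g k j) \<le> (norm (u j) * knorm (k - j)) * norm (g (k - j))"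
    unfolding advection_term_def norm_mult by (intro mult_right_mono norm_cdot_i_kvec_le) auto
  also have "\<dots> = knorm j powr - p * knorm (k - j) powr - s * (weighted p u j * weighted (s + 1) g (k - j))"
    using pos by (simp add: weighted_def powr_add powr_minus_divide del: knorm_eq_0_iff)
  finally show ?thesis .
qed

text \<open>The trilinear estimate tested with the unit mass at \<open>k\<close>; the factor
  \<open>knorm k powr s\<close>, being at least 1, can be inserted for free.\<close>

lemma advection_mode_sum_le:
  assumes C: "conv_const s p C" and u0: "u 0 = 0" and u: "sobsq p u < \<infinity>" and g: "sobsq (s + 1) g < \<infinity>"
    and "0 \<le> s" "k \<noteq> 0" "finite J"
  shows "(\<Sum>j\<in>J. norm (advection_term u g k j)) \<le> C * sobnorm p u * sobnorm (s + 1) g"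
proof -
  let ?h = "\<lambda>l. if l = k then 1 else 0 :: real"
  have h: "l2_bounded 1 ?h"
    unfolding l2_bounded_def L2_set_def by (auto simp: if_distrib[of "\<lambda>x. x\<^sup>2"] sum.delta cong: if_cong)
  let ?t = "\<lambda>(k, j). knorm k powr s * knorm j powr - p * knorm (k - j) powr - s *
    (weighted p u j * weighted (s + 1) g (k - j) * ?h k)"
  have k: "1 \<le> knorm k powr s" using knorm_ge_1[OF \<open>k \<noteq> 0\<close>] \<open>0 \<le> s\<close> by (simp add: ge_one_powr_ge_zero)
  have "(\<Sum>j\<in>J. norm (advection_term u g k j)) \<le> (\<Sum>j\<in>J. ?t (k, j))"
  proof (rule sum_mono)
    fix j
    have "norm (advection_term u g k j) \<le> 1 *
      (knorm j powr - p * knorm (k - j) powr - s * (weighted p u j * weighted (s + 1) g (k - j)))"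
      using norm_advection_term_le[of u g k j p s, OF u0] by simp
    also have "\<dots> \<le> knorm k powr s *
      (knorm j powr - p * knorm (k - j) powr - s * (weighted p u j * weighted (s + 1) g (k - j)))"
      by (intro mult_right_mono k) auto
    finally show "norm (advection_term u g k j) \<le> ?t (k, j)" by (simp add: mult_ac)
  qed
  also have "\<dots> = sum ?t (Pair k ` J)" by (subst sum.reindex) (auto simp: inj_on_def)
  also have "\<dots> \<le> C * sobnorm p u * sobnorm (s + 1) g * 1"
    by (rule conv_constD[OF C]) (use h u g assms l2_bounded_sobnorm in auto)
  finally show ?thesis by simp
qed

lemma
  assumes "conv_const s p C" "u 0 = 0" "sobsq p u < \<infinity>" "sobsq (s + 1) g < \<infinity>" "0 \<le> s" "k \<noteq> 0"
  shows advection_summable: "advection_term u g k summable_on UNIV"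
    and norm_adv_s_le: "norm (adv_s u g k) \<le> C * sobnorm p u * sobnorm (s + 1) g"
  unfolding adv_s_eq
  by (rule summable_of_bounded_sums, rule advection_mode_sum_le[OF assms], assumption)+

text \<open>Sums to the real L^2 pairing of \<Lambda>^s (u . grad g) with \<Lambda>^s h, since
  \<open>\<bullet>\<close> on complex numbers is the real part of the Hermitian product. The family
  is indexed by pairs because the commutator cancellation permutes pairs and does not respect
  rows.\<close>

definition transport_pair :: "real \<Rightarrow> vfield \<Rightarrow> sfield \<Rightarrow> sfield \<Rightarrow> freq \<times> freq \<Rightarrow> real" where
  "transport_pair s u g h = (\<lambda>(k, j). knorm k powr (2 * s) * (advection_term u g k j \<bullet> h k))"

definition transport_form :: "real \<Rightarrow> vfield \<Rightarrow> sfield \<Rightarrow> sfield \<Rightarrow> freq \<Rightarrow> real" where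
  "transport_form s u g h k = knorm k powr (2 * s) * (adv_s u g k \<bullet> h k)"

lemma powr_double: "knorm k powr (2 * s) = knorm k powr s * knorm k powr s"
  by (simp flip: powr_add)

text \<open>One factor \<open>knorm k powr s\<close> becomes the weight of \<open>h\<close>, the
  other enters the trilinear estimate. Cancellation is ignored at the cost of a derivative of
  \<open>g\<close>: affordable when \<open>g\<close> is a solution, while for a difference the bound
  supplies only summability and domination.\<close>

lemma transport_pair_sum_le:
  assumes C: "conv_const s p C" and u0: "u 0 = 0" and u: "sobsq p u < \<infinity>" and g: "sobsq (s + 1) g < \<infinity>"
    and h: "sobsq s h < \<infinity>" and F: "finite F"
  shows "(\<Sum>x\<in>F. norm (transport_pair s u g h x)) \<le> C * sobnorm p u * sobnorm (s + 1) g * sobnorm s h"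
proof -
  have "(\<Sum>x\<in>F. norm (transport_pair s u g h x)) \<le>
    (\<Sum>(k, j)\<in>F. knorm k powr s * knorm j powr - p * knorm (k - j) powr - s *
    (weighted p u j * weighted (s + 1) g (k - j) * weighted s h k))"
  proof (rule sum_mono, clarify)
    fix k j
    have "norm (transport_pair s u g h (k, j)) \<le>
      knorm k powr (2 * s) * (norm (advection_term u g k j) * norm (h k))"
      unfolding transport_pair_def
      by (simp add: abs_mult) (intro mult_left_mono Cauchy_Schwarz_ineq2, simp)
    also have "\<dots> \<le> knorm k powr (2 * s) * ((knorm j powr - p * knorm (k - j) powr - s *
      (weighted p u j * weighted (s + 1) g (k - j))) * norm (h k))"
      by (intro mult_left_mono mult_right_mono norm_advection_term_le u0) auto
    also have "\<dots> = knorm k powr s * knorm j powr - p * knorm (k - j) powr - s *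
      (weighted p u j * weighted (s + 1) g (k - j) * weighted s h k)"
      by (simp add: powr_double weighted_def[of s h])
    finally show "norm (transport_pair s u g h (k, j)) \<le> \<dots>" .
  qed
  also have "\<dots> \<le> C * sobnorm p u * sobnorm (s + 1) g * sobnorm s h"
    by (rule conv_constD[OF C]) (use h u g F l2_bounded_sobnorm in auto)
  finally show ?thesis .
qed

lemma transport_pair_row_has_sum:
  assumes "conv_const s p C" "u 0 = 0" "sobsq p u < \<infinity>" "sobsq (s + 1) g < \<infinity>" "0 \<le> s"
  shows "((\<lambda>j. transport_pair s u g h (k, j)) has_sum transport_form s u g h k) UNIV"
proof (cases "k = 0")
  case True
  then show ?thesis by (simp add: transport_pair_def transport_form_def)
next
  case False
  have "(advection_term u g k has_sum adv_s u g k) UNIV"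
    unfolding adv_s_eq by (intro has_sum_infsum advection_summable[OF assms False])
  then have "((\<lambda>j. knorm k powr (2 * s) * (advection_term u g k j \<bullet> h k)) has_sum
    knorm k powr (2 * s) * (adv_s u g k \<bullet> h k)) UNIV"
    by (intro has_sum_cmult_right has_sum_bounded_linear[OF bounded_linear_inner_left])
  then show ?thesis by (simp add: transport_pair_def transport_form_def)
qed

text \<open>Absolute summability over pairs is the source of all four claims. Summing rows first
  links the form that occurs in the equations to the double sum, which in turn may be
  rearranged.\<close>

lemma
  assumes C: "conv_const s p C" and u0: "u 0 = 0" and u: "sobsq p u < \<infinity>" and g: "sobsq (s + 1) g < \<infinity>"
    and h: "sobsq s h < \<infinity>" and s: "0 \<le> s"
  defines "M \<equiv> C * sobnorm p u * sobnorm (s + 1) g * sobnorm s h"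
  shows transport_form_has_sum:
      "(transport_form s u g h has_sum infsum (transport_pair s u g h) UNIV) UNIV"
    and transport_form_sum_le: "finite A \<Longrightarrow> (\<Sum>k\<in>A. \<bar>transport_form s u g h k\<bar>) \<le> M"
    and transport_pair_infsum_le: "\<bar>infsum (transport_pair s u g h) UNIV\<bar> \<le> M"
    and transport_pair_summable: "transport_pair s u g h summable_on UNIV"
proof -
  note le = transport_pair_sum_le[OF C u0 u g h, folded M_def]
  note row = transport_pair_row_has_sum[OF C u0 u g s]
  show summ: "transport_pair s u g h summable_on UNIV"
    and "\<bar>infsum (transport_pair s u g h) UNIV\<bar> \<le> M"
    using summable_of_bounded_sums[of UNIV "transport_pair s u g h" M] le by auto
  show "(transport_form s u g h has_sum infsum (transport_pair s u g h) UNIV) UNIV"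
  proof (rule has_sum_SigmaD[where B="\<lambda>_. UNIV"])
    show "(transport_pair s u g h has_sum infsum (transport_pair s u g h) UNIV) (UNIV \<times> UNIV)"
      using has_sum_infsum[OF summ] by simp
  qed (rule row)
  show "(\<Sum>k\<in>A. \<bar>transport_form s u g h k\<bar>) \<le> M" if "finite A"
    by (rule sum_row_sums_le[OF le row that])
qed

text \<open>Mean value theorem, with the derivative estimated at the larger point. The case
  \<open>b = 0\<close> is separate because \<open>powr\<close> is differentiated only at positive
  points.\<close>

lemma powr_diff_le:
  fixes a b q :: real
  assumes "0 \<le> b" "b \<le> a" "1 \<le> q"
  shows "a powr q - b powr q \<le> q * a powr (q - 1) * (a - b)"
proof (cases "b = 0 \<or> a = b")
  case True
  show ?thesis
  proof (cases "a = 0")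
    case False
    then have "0 < a" using assms by simp
    then have "a powr q = a powr (q - 1) * a" by (simp add: powr_diff)
    moreover have "1 * (a powr (q - 1) * a) \<le> q * (a powr (q - 1) * a)"
      using assms \<open>0 < a\<close> by (intro mult_right_mono) auto
    ultimately show ?thesis using True assms by auto
  qed (use assms in auto)
next
  case False
  then have ab: "0 < b" "b < a" using assms by auto
  have "((\<lambda>x. x powr q) has_real_derivative q * x powr (q - 1)) (at x)" if "b \<le> x" for x
    using that ab by (auto intro!: derivative_eq_intros)
  then obtain z where z: "b < z" "z < a" "a powr q - b powr q = (a - b) * (q * z powr (q - 1))"
    using MVT2[of b a "\<lambda>x. x powr q" "\<lambda>x. q * x powr (q - 1)"] ab by auto
  have "z powr (q - 1) \<le> a powr (q - 1)" using z ab assms by (intro powr_mono2) auto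
  then show ?thesis unfolding z(3) using ab assms
    by (metis (no_types) diff_ge_0_iff_ge less_imp_le mult.commute mult_left_mono order_trans zero_le_one)
qed

section \<open>Commutator cancellation\<close>

text \<open>Divergence freeness replaces \<open>k - j\<close> by \<open>k\<close> in the derivative
  factor, so both terms carry the number \<open>cdot (u j) (kvec k)\<close>, conjugated in the
  reflected one because \<open>u\<close> is real. The Hermitian products with \<open>g\<close> are
  then negative conjugates of each other. The same replacement gives the second bound, in which the
  derivative falls on \<open>k\<close>.\<close>

lemma advection_term_reflect:
  assumes real: "u (- j) = vcnj (u j)" and div: "cdot (u j) (kvec j) = 0"
  shows "advection_term u g (k - j) (- j) \<bullet> g (k - j) = - (advection_term u g k j \<bullet> g k)"
    and "norm (advection_term u g k j) \<le> norm (u j) * knorm k * norm (g (k - j))"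
proof -
  define d where "d = cdot (u j) (kvec k)"
  have scal: "cdot w (\<i> *s kvec m) = \<i> * cdot w (kvec m)" for w m
    by (simp add: cdot_def sum_distrib_left mult_ac)
  have "cdot (u j) (kvec (k - j)) = d"
    using div by (simp add: d_def kvec_diff cdot_def right_diff_distrib sum_subtractf)
  then have t: "advection_term u g k j = \<i> * d * g (k - j)"
    by (simp add: advection_term_def scal)
  have "cdot (vcnj w) (kvec m) = cnj (cdot w (kvec m))" for w m
    by (simp add: cdot_def vcnj_def kvec_def)
  then have t': "advection_term u g (k - j) (- j) = \<i> * cnj d * g k"
    by (simp add: advection_term_def scal real d_def)
  show "advection_term u g (k - j) (- j) \<bullet> g (k - j) = - (advection_term u g k j \<bullet> g k)"
    unfolding t t' by (simp add: inner_complex_def algebra_simps)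
  have "norm d \<le> norm (u j) * knorm k"
    unfolding d_def using norm_cdot_le[of "u j" "kvec k"] by (simp add: norm_kvec)
  then show "norm (advection_term u g k j) \<le> norm (u j) * knorm k * norm (g (k - j))"
    unfolding t by (simp add: norm_mult mult_right_mono)
qed

text \<open>For a real divergence free \<open>u\<close> the involution \<open>(k, j) \<mapsto> (k - j, - j)\<close> reverses the sign of the
  unweighted pairing, so only the difference of the weights at \<open>k\<close> and \<open>k - j\<close> survives, which is
  controlled by \<open>\<bar>j\<bar>\<close>.\<close>

lemma transport_pair_symmetrized_le:
  fixes g :: sfield
  assumes real: "u (- j) = vcnj (u j)" and div: "cdot (u j) (kvec j) = 0" and s: "1 \<le> s"
  defines "t \<equiv> (\<lambda>(k, j). knorm j * norm (u j) * knorm k powr (s - 1) *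
    (knorm (k - j) * norm (g (k - j))) * (knorm k powr s * norm (g k)))"
  shows "\<bar>transport_pair s u g g (k, j) + transport_pair s u g g (k - j, - j)\<bar>
    \<le> 2 * s * (t (k, j) + t (k - j, - j))"
proof -
  let ?K = "knorm k" and ?M = "knorm (k - j)"
  let ?a = "advection_term u g k j"
  let ?g = "norm (g (k - j)) * norm (g k)"
  note refl = advection_term_reflect[of u j g k, OF real div]
  have uj: "norm (u (- j)) = norm (u j)" unfolding real by (simp add: vcnj_def norm_vec_def)
  have t0: "0 \<le> t x" for x by (auto simp: t_def split: prod.split)
  have t1: "t (k, j) = knorm j * norm (u j) * ?M * ?g * ?K powr (2 * s - 1)"
    unfolding t_def using powr_add[of ?K "s - 1" s] by (simp add: mult_ac)
  have t2: "t (k - j, - j) = knorm j * norm (u j) * ?K * ?g * ?M powr (2 * s - 1)"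
    unfolding t_def using powr_add[of ?M "s - 1" s] by (simp add: mult_ac uj)
  have eq: "transport_pair s u g g (k, j) + transport_pair s u g g (k - j, - j) =
     (?K powr (2 * s) - ?M powr (2 * s)) * (?a \<bullet> g k)"
    unfolding transport_pair_def by (simp add: refl(1) algebra_simps)
  have CS: "\<bar>?a \<bullet> g k\<bar> \<le> norm ?a * norm (g k)" by (rule Cauchy_Schwarz_ineq2)
  have "norm ?a \<le> norm (u j) * ?M * norm (g (k - j))"
    unfolding advection_term_def norm_mult by (intro mult_right_mono norm_cdot_i_kvec_le) auto
  then have aM: "\<bar>?a \<bullet> g k\<bar> \<le> norm (u j) * ?M * ?g"
    by (intro order_trans[OF CS]) (simp add: mult_right_mono flip: mult.assoc)
  have aK: "\<bar>?a \<bullet> g k\<bar> \<le> norm (u j) * ?K * ?g"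
    by (intro order_trans[OF CS]) (use refl(2) in \<open>simp add: mult_right_mono flip: mult.assoc\<close>)
  have d: "\<bar>?K - ?M\<bar> \<le> knorm j" by (rule abs_knorm_diff_le)
  show ?thesis
  \<comment> \<open>The larger frequency takes the power \<open>2 * s - 1\<close> from the mean
    value theorem, and \<open>aM\<close> or \<open>aK\<close> places the derivative on the smaller
    one. Each case thereby reproduces \<open>t\<close> at one of the two reflected pairs.\<close>
  proof (cases "?M \<le> ?K")
    case True
    have "?K powr (2 * s) - ?M powr (2 * s) \<le> 2 * s * ?K powr (2 * s - 1) * (?K - ?M)"
      using True s by (intro powr_diff_le) auto
    also have "\<dots> \<le> 2 * s * ?K powr (2 * s - 1) * knorm j"
      using d s by (intro mult_left_mono) auto
    finally have "\<bar>?K powr (2 * s) - ?M powr (2 * s)\<bar> \<le> 2 * s * ?K powr (2 * s - 1) * knorm j"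
      using powr_mono2[OF _ _ True, of "2 * s"] s by simp
    then have "\<bar>(?K powr (2 * s) - ?M powr (2 * s)) * (?a \<bullet> g k)\<bar> \<le>
      (2 * s * ?K powr (2 * s - 1) * knorm j) * (norm (u j) * ?M * ?g)"
      unfolding abs_mult using aM s by (intro mult_mono) auto
    also have "\<dots> = 2 * s * t (k, j)" unfolding t1 by (simp add: mult_ac)
    also have "\<dots> \<le> 2 * s * (t (k, j) + t (k - j, - j))" using t0 s by simp
    finally show ?thesis unfolding eq .
  next
    case False
    then have KM: "?K \<le> ?M" by simp
    have "?M powr (2 * s) - ?K powr (2 * s) \<le> 2 * s * ?M powr (2 * s - 1) * (?M - ?K)"
      using KM s by (intro powr_diff_le) auto
    also have "\<dots> \<le> 2 * s * ?M powr (2 * s - 1) * knorm j"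
      using d s by (intro mult_left_mono) auto
    finally have "\<bar>?K powr (2 * s) - ?M powr (2 * s)\<bar> \<le> 2 * s * ?M powr (2 * s - 1) * knorm j"
      using powr_mono2[OF _ _ KM, of "2 * s"] s by simp
    then have "\<bar>(?K powr (2 * s) - ?M powr (2 * s)) * (?a \<bullet> g k)\<bar> \<le>
      (2 * s * ?M powr (2 * s - 1) * knorm j) * (norm (u j) * ?K * ?g)"
      unfolding abs_mult using aK s by (intro mult_mono) auto
    also have "\<dots> = 2 * s * t (k - j, - j)" unfolding t2 by (simp add: mult_ac)
    also have "\<dots> \<le> 2 * s * (t (k, j) + t (k - j, - j))" using t0 s by simp
    finally show ?thesis unfolding eq .
  qed
qed

text \<open>The difference of weights trades the derivative of \<open>g\<close> for one of
  \<open>u\<close>, so the trilinear estimate applies in order \<open>s - 1\<close> with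
  \<open>u\<close> in order \<open>p + 1\<close>. The constant \<open>C'\<close> and the finiteness
  of \<open>g\<close> in order \<open>s + 1\<close> make the double family summable and so open to
  rearrangement; the bound itself involves \<open>g\<close> in order \<open>s\<close>.\<close>

lemma transport_commutator_le:
  assumes C: "conv_const (s - 1) p C" and C': "conv_const s p C'" and s: "1 \<le> s"
    and u0: "u 0 = 0" and real: "\<And>k. u (- k) = vcnj (u k)" and div: "\<And>k. cdot (u k) (kvec k) = 0"
    and u: "sobsq (p + 1) u < \<infinity>" and g: "sobsq (s + 1) g < \<infinity>"
  shows "\<bar>infsum (transport_pair s u g g) UNIV\<bar> \<le> 2 * s * C * sobnorm (p + 1) u * (sobnorm s g)\<^sup>2"
proof -
  define t where "t = (\<lambda>(k, j). knorm j * norm (u j) * knorm k powr (s - 1) *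
    (knorm (k - j) * norm (g (k - j))) * (knorm k powr s * norm (g k)))"
  define R where "R = (\<lambda>(k, j). (k - j, - j) :: freq \<times> freq)"
  have gs: "sobsq s g < \<infinity>" by (rule sobsq_finite_mono[OF g]) simp
  have up: "sobsq p u < \<infinity>" by (rule sobsq_finite_mono[OF u]) simp
  have RR: "R (R x) = x" for x by (simp add: R_def split: prod.split)
  have bij: "bij R" by (rule o_bij[of R]) (auto simp: RR fun_eq_iff)
  let ?P = "transport_pair s u g g" and ?M = "C * sobnorm (p + 1) u * sobnorm s g * sobnorm s g"
  have t_le: "sum t F \<le> ?M" if "finite F" for F
  proof -
    have "sum t F \<le> (\<Sum>(k, j)\<in>F. knorm k powr (s - 1) * knorm j powr - p * knorm (k - j) powr - (s - 1) *
      (weighted (p + 1) u j * weighted s g (k - j) * weighted s g k))"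
    proof (rule sum_mono, clarify)
      fix k j
      show "t (k, j) \<le> knorm k powr (s - 1) * knorm j powr - p * knorm (k - j) powr - (s - 1) *
        (weighted (p + 1) u j * weighted s g (k - j) * weighted s g k)"
      proof (cases "j = 0 \<or> k = j")
        case False
        then have pos: "0 < knorm j" "0 < knorm (k - j)" by (auto intro: knorm_pos)
        have "knorm j powr - p * knorm j powr (p + 1) = knorm j"
          "knorm (k - j) powr - (s - 1) * knorm (k - j) powr s = knorm (k - j)"
          using pos by (simp_all flip: powr_add)
        then have "knorm j * norm (u j) * knorm k powr (s - 1) * (knorm (k - j) * norm (g (k - j))) * 
            (knorm k powr s * norm (g k)) =
          (knorm j powr - p * knorm j powr (p + 1)) * norm (u j) * knorm k powr (s - 1) * 
          ((knorm (k - j) powr - (s - 1) * knorm (k - j) powr s) * norm (g (k - j))) * 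
          (knorm k powr s * norm (g k))" by simp
        then have "t (k, j) = knorm k powr (s - 1) * knorm j powr - p * knorm (k - j) powr - (s - 1) *
          (weighted (p + 1) u j * weighted s g (k - j) * weighted s g k)"
          unfolding t_def prod.case by (rule trans) (simp only: weighted_def mult_ac)
        then show ?thesis by simp
      qed (auto simp: t_def)
    qed
    also have "\<dots> \<le> ?M"
      by (rule conv_constD[OF C]) (use gs u that l2_bounded_sobnorm in auto)
    finally show ?thesis .
  qed
  have sum: "?P summable_on UNIV"
    by (rule transport_pair_summable[OF C' u0 up g gs]) (use s in simp)
  have sumR: "(\<lambda>x. ?P (R x)) summable_on UNIV"
    using summable_on_reindex_bij_betw[OF bij, of ?P] sum by simp
  \<comment> \<open>Adding the sum to its own reindexing under \<open>R\<close> produces the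
    symmetrized pairs, whose sums over a finite \<open>F\<close> are controlled by \<open>t\<close>
    on \<open>F\<close> and on the image of \<open>F\<close>.\<close>
  have "2 * infsum ?P UNIV = infsum ?P UNIV + infsum (\<lambda>x. ?P (R x)) UNIV"
    using infsum_reindex_bij_betw[OF bij, of ?P] by simp
  also have "\<dots> = infsum (\<lambda>x. ?P x + ?P (R x)) UNIV"
    by (rule infsum_add[symmetric, OF sum sumR])
  finally have two: "2 * infsum ?P UNIV = infsum (\<lambda>x. ?P x + ?P (R x)) UNIV" .
  have "norm (infsum (\<lambda>x. ?P x + ?P (R x)) UNIV) \<le> 2 * s * (?M + ?M)"
  proof (rule summable_of_bounded_sums(3))
    fix F :: "(freq \<times> freq) set" assume F: "finite F"
    have "(\<Sum>x\<in>F. norm (?P x + ?P (R x))) \<le> (\<Sum>x\<in>F. 2 * s * (t x + t (R x)))"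
    proof (rule sum_mono, clarify)
      fix k j
      show "norm (?P (k, j) + ?P (R (k, j))) \<le> 2 * s * (t (k, j) + t (R (k, j)))"
        using transport_pair_symmetrized_le[of u j s g k, OF real div s]
        unfolding R_def t_def by (simp only: prod.case real_norm_def)
    qed
    also have "\<dots> = 2 * s * (sum t F + sum t (R ` F))"
      by (subst sum.reindex[OF inj_on_subset[OF bij_is_inj[OF bij]]])
        (simp_all add: sum.distrib flip: sum_distrib_left)
    also have "\<dots> \<le> 2 * s * (?M + ?M)"
      using s F by (intro mult_left_mono add_mono t_le) auto
    finally show "(\<Sum>x\<in>F. norm (?P x + ?P (R x))) \<le> 2 * s * (?M + ?M)" .
  qed
  then have "\<bar>infsum ?P UNIV\<bar> \<le> 2 * s * ?M"
    unfolding two[symmetric] real_norm_def by (simp only: distrib_left abs_mult)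
  then show ?thesis by (simp add: power2_eq_square mult_ac)
qed

section \<open>Velocities and components\<close>

lemma velocity_0 [simp]: "velocity \<alpha> v 0 = 0"
  by (simp add: velocity_def)

lemma velocity_real:
  assumes "v (- k) = vcnj (v k)" shows "velocity \<alpha> v (- k) = vcnj (velocity \<alpha> v k)"
  using assms by (simp add: velocity_def vcnj_def vec_eq_iff)

lemma velocity_div_free:
  assumes "cdot (v k) (kvec k) = 0" shows "cdot (velocity \<alpha> v k) (kvec k) = 0"
  using assms by (simp add: velocity_def cdot_def mult.assoc flip: sum_distrib_left)

lemma velocity_diff: "velocity \<alpha> (v - v') = velocity \<alpha> v - velocity \<alpha> v'"
  by (auto simp: velocity_def fun_eq_iff vec_eq_iff right_diff_distrib)

lemma weighted_velocity: "weighted s (velocity \<alpha> v) = weighted (s - 2 * \<alpha>) v"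
proof
  fix k show "weighted s (velocity \<alpha> v) k = weighted (s - 2 * \<alpha>) v k"
    using powr_add[of "knorm k" s "- 2 * \<alpha>"]
    by (cases "k = 0") (simp_all add: weighted_def velocity_def norm_vector_smult)
qed

lemma sobsq_velocity: "sobsq s (velocity \<alpha> v) = sobsq (s - 2 * \<alpha>) v"
  by (simp add: sobsq_eq_SUP weighted_velocity)

lemma sobnorm_velocity: "sobnorm s (velocity \<alpha> v) = sobnorm (s - 2 * \<alpha>) v"
  by (simp add: sobnorm_def sobsq_velocity)

definition component :: "vfield \<Rightarrow> 3 \<Rightarrow> sfield" where
  "component v c = (\<lambda>k. v k $ c)"

lemma component_diff: "component (v - v') c = component v c - component v' c"
  by (simp add: component_def fun_eq_iff)

lemma weighted_component_le: "weighted s (component v c) k \<le> weighted s v k"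
  by (simp add: weighted_def component_def mult_left_mono Finite_Cartesian_Product.norm_nth_le)

lemmas sobsq_component = sobsq_finite_compare[OF _ weighted_component_le]
lemmas sobnorm_component_le = sobnorm_compare[OF _ weighted_component_le]

text \<open>Reduces vector transport to three scalar transports. Summability of the vector series
  has to come first, since \<open>infsum\<close> of a family that is not summable is 0 by default
  and need not commute with taking components.\<close>

lemma adv_v_component:
  assumes "conv_const s p C" "u 0 = 0" "sobsq p u < \<infinity>" "sobsq (s + 1) v < \<infinity>" "0 \<le> s" "k \<noteq> 0"
  shows "adv_v u v k $ c = adv_s u (component v c) k"
proof -
  let ?t = "\<lambda>j. cdot (u j) (\<i> *s kvec (k - j)) *s v (k - j)"
  let ?M = "\<Sum>c\<in>UNIV. C * sobnorm p u * sobnorm (s + 1) (component v c)"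
  have "?t summable_on UNIV"
  proof (rule summable_of_bounded_sums(2))
    fix F :: "freq set" assume F: "finite F"
    have "(\<Sum>j\<in>F. norm (?t j)) \<le> (\<Sum>j\<in>F. \<Sum>c\<in>UNIV. norm (advection_term u (component v c) k j))"
    proof (rule sum_mono)
      fix j
      show "norm (?t j) \<le> (\<Sum>c\<in>UNIV. norm (advection_term u (component v c) k j))"
        unfolding norm_vec_def by (rule order_trans[OF L2_set_le_sum])
          (auto simp: advection_term_def component_def)
    qed
    also have "\<dots> = (\<Sum>c\<in>UNIV. \<Sum>j\<in>F. norm (advection_term u (component v c) k j))"
      by (rule sum.swap)
    also have "\<dots> \<le> ?M"
      by (intro sum_mono advection_mode_sum_le[OF assms(1-3) sobsq_component[OF assms(4)] assms(5,6) F])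
    finally show "(\<Sum>j\<in>F. norm (?t j)) \<le> ?M" .
  qed
  then have "((\<lambda>j. ?t j $ c) has_sum adv_v u v k $ c) UNIV"
    unfolding adv_v_def by (intro has_sum_bounded_linear[OF bounded_linear_vec_nth] has_sum_infsum)
  then show ?thesis
    unfolding adv_s_def component_def by (simp add: infsumI)
qed

section \<open>Bilinear splitting of differences\<close>

lemma adv_s_diff_left:
  assumes "conv_const s p C" "u 0 = 0" "u' 0 = 0" "sobsq p u < \<infinity>" "sobsq p u' < \<infinity>"
    "sobsq (s + 1) g < \<infinity>" "0 \<le> s" "k \<noteq> 0"
  shows "adv_s (u - u') g k = adv_s u g k - adv_s u' g k"
proof -
  have "advection_term (u - u') g k = (\<lambda>j. advection_term u g k j + - advection_term u' g k j)"
    by (simp add: advection_term_def cdot_def fun_eq_iff algebra_simps sum_subtractf)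
  then have "adv_s (u - u') g k = infsum (\<lambda>j. advection_term u g k j + - advection_term u' g k j) UNIV"
    unfolding adv_s_eq by simp
  also have "\<dots> = adv_s u g k - adv_s u' g k"
    unfolding adv_s_eq
    using advection_summable[OF assms(1,2,4,6-8)] advection_summable[OF assms(1,3,5,6-8)]
    by (subst infsum_add) (auto simp: infsum_uminus summable_on_uminus)
  finally show ?thesis .
qed

lemma adv_s_diff_right:
  assumes "conv_const s p C" "u 0 = 0" "sobsq p u < \<infinity>"
    "sobsq (s + 1) g < \<infinity>" "sobsq (s + 1) g' < \<infinity>" "0 \<le> s" "k \<noteq> 0"
  shows "adv_s u (g - g') k = adv_s u g k - adv_s u g' k"
proof -
  have "advection_term u (g - g') k = (\<lambda>j. advection_term u g k j + - advection_term u g' k j)"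
    by (simp add: advection_term_def fun_eq_iff algebra_simps)
  then have "adv_s u (g - g') k = infsum (\<lambda>j. advection_term u g k j + - advection_term u g' k j) UNIV"
    unfolding adv_s_eq by simp
  also have "\<dots> = adv_s u g k - adv_s u g' k"
    unfolding adv_s_eq
    using advection_summable[OF assms(1-4,6-7)] advection_summable[OF assms(1-3,5-7)]
    by (subst infsum_add) (auto simp: infsum_uminus summable_on_uminus)
  finally show ?thesis .
qed

text \<open>Of the two possible splittings, this one lets the second velocity transport the
  difference and puts the gradient of the first solution under the velocity difference. This is why
  the final constant involves \<open>\<theta>1\<close> and not \<open>\<theta>2\<close>.\<close>

lemma adv_s_difference:
  assumes "conv_const s p C" "u1 0 = 0" "u2 0 = 0" "sobsq p u1 < \<infinity>" "sobsq p u2 < \<infinity>"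
    "sobsq (s + 1) g1 < \<infinity>" "sobsq (s + 1) g2 < \<infinity>" "0 \<le> s" "k \<noteq> 0"
  shows "adv_s u1 g1 k - adv_s u2 g2 k = adv_s u2 (g1 - g2) k + adv_s (u1 - u2) g1 k"
  using adv_s_diff_left[OF assms(1-5) assms(6) assms(8,9)]
    adv_s_diff_right[OF assms(1,3,5,6,7,8,9)] by simp

section \<open>Continuity in time\<close>

lemma cont_in_compare:
  assumes g: "cont_in t g T" and fin: "\<And>\<tau>. \<tau> \<in> {0..T} \<Longrightarrow> sobsq t (g \<tau>) < \<infinity>"
    and le: "\<And>\<tau> \<tau>' k. \<tau> \<in> {0..T} \<Longrightarrow> \<tau>' \<in> {0..T} \<Longrightarrow> weighted s (f \<tau> - f \<tau>') k \<le> weighted t (g \<tau> - g \<tau>') k"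
  shows "cont_in s f T"
  unfolding cont_in_def
proof
  fix x assume x: "x \<in> {0..T}"
  show "((\<lambda>\<tau>. sobnorm s (f \<tau> - f x)) \<longlongrightarrow> 0) (at x within {0..T})"
  proof (rule tendsto_sandwich[OF _ _ tendsto_const])
    show "((\<lambda>\<tau>. sobnorm t (g \<tau> - g x)) \<longlongrightarrow> 0) (at x within {0..T})"
      using g x by (simp add: cont_in_def)
    show "\<forall>\<^sub>F \<tau> in at x within {0..T}. sobnorm s (f \<tau> - f x) \<le> sobnorm t (g \<tau> - g x)"
      by (auto simp: eventually_at_filter intro!: always_eventually sobnorm_compare
        sobsq_finite_diff fin x le)
  qed simp
qed

lemma cont_in_mono:
  assumes "cont_in t f T" "\<And>\<tau>. \<tau> \<in> {0..T} \<Longrightarrow> sobsq t (f \<tau>) < \<infinity>" "s \<le> t"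
  shows "cont_in s f T"
  by (rule cont_in_compare[OF assms(1,2)]) (use assms(3) weighted_le_weighted in auto)

lemma cont_in_component:
  assumes "cont_in s f T" "\<And>\<tau>. \<tau> \<in> {0..T} \<Longrightarrow> sobsq s (f \<tau>) < \<infinity>"
  shows "cont_in s (\<lambda>t. component (f t) c) T"
  by (rule cont_in_compare[OF assms]) (auto simp: weighted_component_le simp flip: component_diff)

lemma cont_in_velocity:
  assumes "cont_in (s - 2 * \<alpha>) f T" shows "cont_in s (\<lambda>t. velocity \<alpha> (f t)) T"
  using assms by (simp add: cont_in_def sobnorm_velocity flip: velocity_diff)

lemma cont_in_diff:
  fixes f g :: "real \<Rightarrow> freq \<Rightarrow> 'a::real_normed_vector"
  assumes "cont_in s f T" "cont_in s g T"
    "\<And>\<tau>. \<tau> \<in> {0..T} \<Longrightarrow> sobsq s (f \<tau>) < \<infinity>" "\<And>\<tau>. \<tau> \<in> {0..T} \<Longrightarrow> sobsq s (g \<tau>) < \<infinity>"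
  shows "cont_in s (\<lambda>t. f t - g t) T"
  unfolding cont_in_def
proof
  fix x assume x: "x \<in> {0..T}"
  show "((\<lambda>\<tau>. sobnorm s (f \<tau> - g \<tau> - (f x - g x))) \<longlongrightarrow> 0) (at x within {0..T})"
  proof (rule tendsto_sandwich[OF _ _ tendsto_const])
    show "((\<lambda>\<tau>. sobnorm s (f \<tau> - f x) + sobnorm s (g \<tau> - g x)) \<longlongrightarrow> 0) (at x within {0..T})"
      using assms(1,2) x by (auto simp: cont_in_def intro!: tendsto_add_zero)
    have "sobnorm s (f \<tau> - g \<tau> - (f x - g x)) \<le> sobnorm s (f \<tau> - f x) + sobnorm s (g \<tau> - g x)"
      if "\<tau> \<in> {0..T}" for \<tau>
    proof -
      have "f \<tau> - g \<tau> - (f x - g x) = (\<lambda>k. (f \<tau> - f x) k + (- (g \<tau> - g x)) k)"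
        by (simp add: fun_eq_iff)
      then show ?thesis
        using sobnorm_triangle[of s "f \<tau> - f x" "- (g \<tau> - g x)"]
          sobsq_finite_diff[OF assms(3)[OF that] assms(3)[OF x]]
          sobsq_finite_diff[OF assms(4)[OF that] assms(4)[OF x]] by simp
    qed
    then show "\<forall>\<^sub>F \<tau> in at x within {0..T}. sobnorm s (f \<tau> - g \<tau> - (f x - g x)) \<le>
        sobnorm s (f \<tau> - f x) + sobnorm s (g \<tau> - g x)"
      by (auto simp: eventually_at_filter intro!: always_eventually)
  qed simp
qed

lemma continuous_on_sobnorm:
  assumes "cont_in s f T" "\<And>\<tau>. \<tau> \<in> {0..T} \<Longrightarrow> sobsq s (f \<tau>) < \<infinity>"
  shows "continuous_on {0..T} (\<lambda>t. sobnorm s (f t))"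
  unfolding continuous_on_def
proof
  fix x assume x: "x \<in> {0..T}"
  have "((\<lambda>\<tau>. sobnorm s (f \<tau>) - sobnorm s (f x)) \<longlongrightarrow> 0) (at x within {0..T})"
  proof (rule Lim_null_comparison)
    show "((\<lambda>\<tau>. sobnorm s (f \<tau> - f x)) \<longlongrightarrow> 0) (at x within {0..T})"
      using assms(1) x by (simp add: cont_in_def)
    show "\<forall>\<^sub>F \<tau> in at x within {0..T}. norm (sobnorm s (f \<tau>) - sobnorm s (f x)) \<le> sobnorm s (f \<tau> - f x)"
      using assms(2) x
      by (auto simp: eventually_at_filter intro!: always_eventually abs_sobnorm_diff_le)
  qed
  then show "((\<lambda>\<tau>. sobnorm s (f \<tau>)) \<longlongrightarrow> sobnorm s (f x)) (at x within {0..T})"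
    by (rule iffD2[OF Lim_null])
qed

text \<open>Continuity on a compact interval bounds the norms in time; the real supremum of an
  unbounded set would be unspecified and bound nothing.\<close>

lemma sobnorm_le_Linfnorm:
  assumes "cont_in s f T" "\<And>\<tau>. \<tau> \<in> {0..T} \<Longrightarrow> sobsq s (f \<tau>) < \<infinity>" "t \<in> {0..T}"
  shows "sobnorm s (f t) \<le> Linfnorm s f T"
proof -
  have "compact ((\<lambda>t. sobnorm s (f t)) ` {0..T})"
    by (intro compact_continuous_image continuous_on_sobnorm assms(1,2)) auto
  then have "bdd_above ((\<lambda>t. sobnorm s (f t)) ` {0..T})"
    by (intro bounded_imp_bdd_above compact_imp_bounded)
  then show ?thesis unfolding Linfnorm_def using assms(3) by (rule cSUP_upper2[OF _ _ order_refl])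
qed

lemma norm_le_sobnorm:
  assumes "sobsq s f < \<infinity>" "0 \<le> s" "k \<noteq> 0"
  shows "norm (f k) \<le> sobnorm s f"
proof -
  have "1 * norm (f k) \<le> weighted s f k"
    unfolding weighted_def using knorm_ge_1[OF assms(3)] assms(2)
    by (intro mult_right_mono) (auto simp: ge_one_powr_ge_zero)
  also have "\<dots> \<le> sobnorm s f"
    using l2_boundedD[OF l2_bounded_sobnorm[OF assms(1)], of "{k}"] by simp
  finally show ?thesis by simp
qed

lemma continuous_on_mode:
  assumes "cont_in s f T" "\<And>\<tau>. \<tau> \<in> {0..T} \<Longrightarrow> sobsq s (f \<tau>) < \<infinity>" "0 \<le> s" "k \<noteq> 0"
  shows "continuous_on {0..T} (\<lambda>t. f t k)"
  unfolding continuous_on_def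
proof
  fix x assume x: "x \<in> {0..T}"
  have "((\<lambda>\<tau>. f \<tau> k - f x k) \<longlongrightarrow> 0) (at x within {0..T})"
  proof (rule Lim_null_comparison)
    show "((\<lambda>\<tau>. sobnorm s (f \<tau> - f x)) \<longlongrightarrow> 0) (at x within {0..T})"
      using assms(1) x by (simp add: cont_in_def)
    have "norm (f \<tau> k - f x k) \<le> sobnorm s (f \<tau> - f x)" if "\<tau> \<in> {0..T}" for \<tau>
      using norm_le_sobnorm[OF sobsq_finite_diff[OF assms(2)[OF that] assms(2)[OF x]] assms(3,4)] by simp
    then show "\<forall>\<^sub>F \<tau> in at x within {0..T}. norm (f \<tau> k - f x k) \<le> sobnorm s (f \<tau> - f x)"
      by (auto simp: eventually_at_filter intro!: always_eventually)
  qed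
  then show "((\<lambda>\<tau>. f \<tau> k) \<longlongrightarrow> f x k) (at x within {0..T})"
    by (rule iffD2[OF Lim_null])
qed

text \<open>Bilinearity splits an increment in time into two terms, each controlled by the
  single-mode bound. Continuity is what turns the integral equations into differential equations for
  the modes.\<close>

lemma continuous_on_adv_s:
  assumes C: "conv_const s p C" and s: "0 \<le> s" and k: "k \<noteq> 0"
    and u0: "\<And>t. t \<in> {0..T} \<Longrightarrow> u t 0 = 0"
    and u: "cont_in p u T" "\<And>t. t \<in> {0..T} \<Longrightarrow> sobsq p (u t) < \<infinity>"
    and g: "cont_in (s + 1) g T" "\<And>t. t \<in> {0..T} \<Longrightarrow> sobsq (s + 1) (g t) < \<infinity>"
  shows "continuous_on {0..T} (\<lambda>t. adv_s (u t) (g t) k)"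
  unfolding continuous_on_def
proof
  fix x assume x: "x \<in> {0..T}"
  let ?du = "\<lambda>\<tau>. sobnorm p (u \<tau> - u x)" and ?dg = "\<lambda>\<tau>. sobnorm (s + 1) (g \<tau> - g x)"
  have lim: "(?du \<longlongrightarrow> 0) (at x within {0..T})" "(?dg \<longlongrightarrow> 0) (at x within {0..T})"
    "((\<lambda>\<tau>. sobnorm (s + 1) (g \<tau>)) \<longlongrightarrow> sobnorm (s + 1) (g x)) (at x within {0..T})"
    using u g x continuous_on_sobnorm[OF g] by (auto simp: cont_in_def continuous_on_def)
  have "((\<lambda>\<tau>. adv_s (u \<tau>) (g \<tau>) k - adv_s (u x) (g x) k) \<longlongrightarrow> 0) (at x within {0..T})"
  proof (rule Lim_null_comparison)
    have "((\<lambda>\<tau>. C * sobnorm p (u x) * ?dg \<tau> + C * ?du \<tau> * sobnorm (s + 1) (g \<tau>)) \<longlongrightarrow>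
      C * sobnorm p (u x) * 0 + C * 0 * sobnorm (s + 1) (g x)) (at x within {0..T})"
      by (intro tendsto_intros lim)
    then show "((\<lambda>\<tau>. C * sobnorm p (u x) * ?dg \<tau> + C * ?du \<tau> * sobnorm (s + 1) (g \<tau>)) \<longlongrightarrow> 0)
      (at x within {0..T})" by simp
    have "norm (adv_s (u \<tau>) (g \<tau>) k - adv_s (u x) (g x) k) \<le>
      C * sobnorm p (u x) * ?dg \<tau> + C * ?du \<tau> * sobnorm (s + 1) (g \<tau>)" if \<tau>: "\<tau> \<in> {0..T}" for \<tau>
    proof -
      have "adv_s (u \<tau>) (g \<tau>) k - adv_s (u x) (g x) k =
        adv_s (u x) (g \<tau> - g x) k + adv_s (u \<tau> - u x) (g \<tau>) k"
        by (rule adv_s_difference[OF C]) (use u0 u g x \<tau> s k in auto)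
      also have "norm \<dots> \<le> C * sobnorm p (u x) * ?dg \<tau> + C * ?du \<tau> * sobnorm (s + 1) (g \<tau>)"
        by (intro norm_triangle_mono norm_adv_s_le[OF C] sobsq_finite_diff)
          (use u0 u g x \<tau> s k in auto)
      finally show ?thesis .
    qed
    then show "\<forall>\<^sub>F \<tau> in at x within {0..T}. norm (adv_s (u \<tau>) (g \<tau>) k - adv_s (u x) (g x) k) \<le>
      C * sobnorm p (u x) * ?dg \<tau> + C * ?du \<tau> * sobnorm (s + 1) (g \<tau>)"
      by (auto simp: eventually_at_filter intro!: always_eventually)
  qed
  then show "((\<lambda>\<tau>. adv_s (u \<tau>) (g \<tau>) k) \<longlongrightarrow> adv_s (u x) (g x) k) (at x within {0..T})"
    by (rule iffD2[OF Lim_null])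
qed

section \<open>The energy flux\<close>

lemma conv_const_mono:
  assumes "conv_const s p C" "C \<le> C'"
  shows "conv_const s p C'"
  unfolding conv_const_def
proof (intro conjI allI impI)
  show "0 \<le> C'" using conv_const_nonneg[OF assms(1)] assms(2) by simp
  fix a b h :: "freq \<Rightarrow> real" and A B H and F :: "(freq \<times> freq) set"
  assume asm: "(\<forall>k. 0 \<le> a k) \<and> (\<forall>k. 0 \<le> b k) \<and> (\<forall>k. 0 \<le> h k) \<and>
    l2_bounded A a \<and> l2_bounded B b \<and> l2_bounded H h \<and> finite F"
  then have "(\<Sum>(k, j)\<in>F. knorm k powr s * knorm j powr - p * knorm (k - j) powr - s *
    (a j * b (k - j) * h k)) \<le> C * A * B * H"
    by (intro conv_constD[OF assms(1)]) auto
  also have "\<dots> \<le> C' * A * B * H"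
    using asm assms(2) by (intro mult_right_mono) (auto dest: l2_bounded_nonneg)
  finally show "(\<Sum>(k, j)\<in>F. knorm k powr s * knorm j powr - p * knorm (k - j) powr - s *
    (a j * b (k - j) * h k)) \<le> C' * A * B * H" .
qed

lemma transport_form_tendsto:
  assumes "conv_const s p C" "u 0 = 0" "sobsq p u < \<infinity>" "sobsq (s + 1) g < \<infinity>"
    "sobsq s h < \<infinity>" "0 \<le> s"
  shows "(\<lambda>N. \<Sum>k\<in>freq_box N. transport_form s u g h k) \<longlonglongrightarrow> infsum (transport_pair s u g h) UNIV"
proof -
  have "(transport_form s u g h has_sum infsum (transport_pair s u g h) UNIV) (UNIV - {0}) \<longleftrightarrow>
    (transport_form s u g h has_sum infsum (transport_pair s u g h) UNIV) UNIV"
    by (rule has_sum_cong_neutral) (auto simp: transport_form_def)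
  then show ?thesis
    using transport_form_has_sum[OF assms] unfolding has_sum_def
    by (auto intro: filterlim_compose[OF _ filterlim_freq_box])
qed

text \<open>Contribution of transport to the time derivative of the energy at the mode
  \<open>k\<close>; the factor 2 comes from differentiating squares. The argument \<open>u\<close>
  is meant to be the velocity of the second solution, \<open>z\<close> the velocity of the
  difference \<open>w\<close>.\<close>

definition energy_flux :: "real \<Rightarrow> real \<Rightarrow> vfield \<Rightarrow> vfield \<Rightarrow> vfield \<Rightarrow> sfield \<Rightarrow> vfield \<Rightarrow> sfield \<Rightarrow> freq \<Rightarrow> real"
  where "energy_flux s \<sigma> u z v \<theta> w \<eta> k =
    - 2 * (\<Sum>c\<in>UNIV. transport_form s u (component w c) (component w c) k + transport_form s z (component v c) (component w c) k)
    - 2 * (transport_form \<sigma> u \<eta> \<eta> k + transport_form \<sigma> z \<theta> \<eta> k)"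

text \<open>Transport of \<open>w\<close> and \<open>\<eta>\<close> by \<open>u\<close> is bounded
  by the commutator estimate, transport by \<open>z\<close> by the plain one, where
  \<open>zw\<close> converts the velocity norm into an energy norm. Cancellation concerns the sum
  over all modes, hence the bound is for the limit \<open>S\<close> and not for box sums.\<close>

lemma energy_flux_tendsto:
  assumes C: "conv_const s p C" "conv_const (s - 1) p C" "conv_const \<sigma> p C" "conv_const (\<sigma> - 1) p C"
    and s: "1 \<le> s" "1 \<le> \<sigma>"
    and u: "u 0 = 0" "\<And>k. u (- k) = vcnj (u k)" "\<And>k. cdot (u k) (kvec k) = 0" "sobsq (p + 1) u < \<infinity>"
    and z: "z 0 = 0" "sobsq p z < \<infinity>"
    and fin: "sobsq (s + 1) v < \<infinity>" "sobsq (s + 1) w < \<infinity>" "sobsq (\<sigma> + 1) \<theta> < \<infinity>" "sobsq (\<sigma> + 1) \<eta> < \<infinity>"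
    and zw: "sobnorm p z \<le> sobnorm s w"
    and R: "sobnorm (p + 1) u \<le> R" "sobnorm (s + 1) v \<le> R" "sobnorm (\<sigma> + 1) \<theta> \<le> R"
  obtains S where "(\<lambda>N. \<Sum>k\<in>freq_box N. energy_flux s \<sigma> u z v \<theta> w \<eta> k) \<longlonglongrightarrow> S"
    and "S \<le> C * R * (12 * s + 4 * \<sigma> + 8) * ((sobnorm s w)\<^sup>2 + (sobnorm \<sigma> \<eta>)\<^sup>2)"
proof -
  have C0: "0 \<le> C" using C(1) by (rule conv_const_nonneg)
  have R0: "0 \<le> R" using R(1) sobnorm_nonneg order_trans by blast
  have up: "sobsq p u < \<infinity>" by (rule sobsq_finite_mono[OF u(4)]) simp
  have ws: "sobsq s w < \<infinity>" and \<eta>s: "sobsq \<sigma> \<eta> < \<infinity>"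
    using sobsq_finite_mono[OF fin(2), of s] sobsq_finite_mono[OF fin(4), of \<sigma>] by auto
  let ?I = "\<lambda>s u g h. infsum (transport_pair s u g h) UNIV"
  let ?W = "sobnorm s w" and ?E = "sobnorm \<sigma> \<eta>"
  define S where "S = - 2 * (\<Sum>c\<in>UNIV. ?I s u (component w c) (component w c) + ?I s z (component v c) (component w c))
    - 2 * (?I \<sigma> u \<eta> \<eta> + ?I \<sigma> z \<theta> \<eta>)"
  have lim: "(\<lambda>N. \<Sum>k\<in>freq_box N. energy_flux s \<sigma> u z v \<theta> w \<eta> k) \<longlonglongrightarrow> S"
  proof -
    have eq: "(\<Sum>k\<in>A. energy_flux s \<sigma> u z v \<theta> w \<eta> k) =
      - 2 * (\<Sum>c\<in>UNIV. (\<Sum>k\<in>A. transport_form s u (component w c) (component w c) k) +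
        (\<Sum>k\<in>A. transport_form s z (component v c) (component w c) k))
      - 2 * ((\<Sum>k\<in>A. transport_form \<sigma> u \<eta> \<eta> k) + (\<Sum>k\<in>A. transport_form \<sigma> z \<theta> \<eta> k))" for A
      unfolding energy_flux_def
      by (simp add: sum_subtractf sum.distrib sum_negf sum.swap[of _ A UNIV] flip: sum_distrib_left)
    show ?thesis
      unfolding eq S_def using s
      by (intro tendsto_intros transport_form_tendsto[OF C(1)] transport_form_tendsto[OF C(3)]
          u(1) up z fin sobsq_component[OF fin(1)] sobsq_component[OF fin(2)] sobsq_component[OF ws] \<eta>s) auto
  qed
  have W: "\<bar>?I s u (component w c) (component w c)\<bar> \<le> 2 * s * C * R * ?W\<^sup>2" for c
  proof -
    have "\<bar>?I s u (component w c) (component w c)\<bar> \<le> 2 * s * C * sobnorm (p + 1) u * (sobnorm s (component w c))\<^sup>2"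
      by (rule transport_commutator_le[OF C(2,1) s(1) u sobsq_component[OF fin(2)]])
    also have "\<dots> \<le> 2 * s * C * R * ?W\<^sup>2"
      using s C0 R R0 by (intro mult_mono power_mono sobnorm_component_le[OF ws]) auto
    finally show ?thesis .
  qed
  have E: "\<bar>?I \<sigma> u \<eta> \<eta>\<bar> \<le> 2 * \<sigma> * C * R * ?E\<^sup>2"
  proof -
    have "\<bar>?I \<sigma> u \<eta> \<eta>\<bar> \<le> 2 * \<sigma> * C * sobnorm (p + 1) u * ?E\<^sup>2"
      by (rule transport_commutator_le[OF C(4,3) s(2) u fin(4)])
    also have "\<dots> \<le> 2 * \<sigma> * C * R * ?E\<^sup>2"
      using s C0 R R0 by (intro mult_mono) auto
    finally show ?thesis .
  qed
  have W': "\<bar>?I s z (component v c) (component w c)\<bar> \<le> C * R * ?W\<^sup>2" for c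
  proof -
    have "\<bar>?I s z (component v c) (component w c)\<bar> \<le> C * sobnorm p z * sobnorm (s + 1) (component v c) * sobnorm s (component w c)"
      by (rule transport_pair_infsum_le[OF C(1) z sobsq_component[OF fin(1)] sobsq_component[OF ws]]) (use s in simp)
    also have "\<dots> \<le> C * ?W * R * ?W"
      using s C0 R0 zw order_trans[OF sobnorm_component_le[OF fin(1)] R(2)]
      by (intro mult_mono sobnorm_component_le[OF ws]) auto
    finally show ?thesis by (simp add: power2_eq_square mult_ac)
  qed
  have E': "\<bar>?I \<sigma> z \<theta> \<eta>\<bar> \<le> C * R * (?W\<^sup>2 + ?E\<^sup>2)"
  proof -
    have "\<bar>?I \<sigma> z \<theta> \<eta>\<bar> \<le> C * sobnorm p z * sobnorm (\<sigma> + 1) \<theta> * ?E"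
      by (rule transport_pair_infsum_le[OF C(3) z fin(3) \<eta>s]) (use s in simp)
    also have "\<dots> \<le> C * ?W * R * ?E"
      using s C0 R R0 zw by (intro mult_mono) auto
    also have "\<dots> = C * R * (?W * ?E)" by simp
    also have "\<dots> \<le> C * R * (?W\<^sup>2 + ?E\<^sup>2)"
    proof (intro mult_left_mono)
      have "2 * ?W * ?E \<le> ?W\<^sup>2 + ?E\<^sup>2" by (rule sum_squares_bound)
      moreover have "0 \<le> ?W * ?E" by simp
      ultimately show "?W * ?E \<le> ?W\<^sup>2 + ?E\<^sup>2" by linarith
    qed (use C0 R0 in auto)
    finally show ?thesis .
  qed
  have "- (\<Sum>c\<in>UNIV. ?I s u (component w c) (component w c) + ?I s z (component v c) (component w c))
      \<le> (\<Sum>c\<in>(UNIV::3 set). 2 * s * C * R * ?W\<^sup>2 + C * R * ?W\<^sup>2)"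
    unfolding sum_negf[symmetric]
  proof (rule sum_mono)
    fix c :: 3
    show "- (?I s u (component w c) (component w c) + ?I s z (component v c) (component w c)) \<le> 2 * s * C * R * ?W\<^sup>2 + C * R * ?W\<^sup>2"
      using W[of c] W'[of c] by linarith
  qed
  also have "\<dots> = 3 * (2 * s * C * R * ?W\<^sup>2 + C * R * ?W\<^sup>2)" by simp
  finally have comps: "- (\<Sum>c\<in>UNIV. ?I s u (component w c) (component w c) + ?I s z (component v c) (component w c))
      \<le> 3 * (2 * s * C * R * ?W\<^sup>2 + C * R * ?W\<^sup>2)" .
  have "S \<le> 2 * (3 * (2 * s * C * R * ?W\<^sup>2 + C * R * ?W\<^sup>2)) +
      2 * (2 * \<sigma> * C * R * ?E\<^sup>2 + C * R * (?W\<^sup>2 + ?E\<^sup>2))"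
  proof -
    have "- 2 * x - 2 * (i + j) \<le> 2 * a + 2 * (b + c)"
      if "- x \<le> a" "\<bar>i\<bar> \<le> b" "\<bar>j\<bar> \<le> c" for x i j a b c :: real
      using that by (simp only: abs_le_iff, simp)
    from this[OF comps E E'] show ?thesis unfolding S_def .
  qed
  \<comment> \<open>Three components with \<open>2 * s + 1\<close> each, doubled, give
    \<open>12 * s + 6\<close> for \<open>?W\<^sup>2\<close>; the temperature gives
    \<open>4 * \<sigma>\<close> for \<open>?E\<^sup>2\<close>; the mixed term adds 2 to both. A
    common factor dominates the two coefficients.\<close>
  also have "\<dots> \<le> C * R * (12 * s + 4 * \<sigma> + 8) * (?W\<^sup>2 + ?E\<^sup>2)"
  proof -
    have "0 \<le> C * R * (4 * \<sigma> * ?W\<^sup>2 + 12 * s * ?E\<^sup>2 + 6 * ?E\<^sup>2)"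
      using C0 R0 s by (intro mult_nonneg_nonneg add_nonneg_nonneg) auto
    then show ?thesis by (simp add: algebra_simps)
  qed
  finally show ?thesis using that lim by blast
qed

text \<open>An arbitrary finite set of modes offers no cancellation, so this is only a domination.
  The number 16 counts doubled forms: six from the vector components and two from the
  temperature.\<close>

lemma energy_flux_sum_le:
  assumes C: "conv_const s p C" "conv_const \<sigma> p C"
    and s: "0 \<le> s" "0 \<le> \<sigma>"
    and u: "u 0 = 0" "sobsq p u < \<infinity>" and z: "z 0 = 0" "sobsq p z < \<infinity>"
    and fin: "sobsq (s + 1) v < \<infinity>" "sobsq (s + 1) w < \<infinity>" "sobsq (\<sigma> + 1) \<theta> < \<infinity>" "sobsq (\<sigma> + 1) \<eta> < \<infinity>"
    and R: "sobnorm p u \<le> R" "sobnorm p z \<le> R" "sobnorm (s + 1) v \<le> R" "sobnorm (s + 1) w \<le> R"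
      "sobnorm (\<sigma> + 1) \<theta> \<le> R" "sobnorm (\<sigma> + 1) \<eta> \<le> R"
    and A: "finite A"
  shows "\<bar>\<Sum>k\<in>A. energy_flux s \<sigma> u z v \<theta> w \<eta> k\<bar> \<le> 16 * (C * R * R * R)"
proof -
  have C0: "0 \<le> C" using C(1) by (rule conv_const_nonneg)
  have R0: "0 \<le> R" using R(1) sobnorm_nonneg order_trans by blast
  have ws: "sobsq s w < \<infinity>" and \<eta>s: "sobsq \<sigma> \<eta> < \<infinity>"
    using sobsq_finite_mono[OF fin(2), of s] sobsq_finite_mono[OF fin(4), of \<sigma>] by auto
  have Rs: "sobnorm s w \<le> R" "sobnorm \<sigma> \<eta> \<le> R"
    using sobnorm_mono[OF fin(2), of s] sobnorm_mono[OF fin(4), of \<sigma>] R(4,6) by auto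
  have gen: "\<bar>\<Sum>k\<in>A. transport_form s' x g h k\<bar> \<le> C * R * R * R"
    if "conv_const s' p C" "0 \<le> s'" "x 0 = 0" "sobsq p x < \<infinity>" "sobsq (s' + 1) g < \<infinity>" "sobsq s' h < \<infinity>"
      "sobnorm p x \<le> R" "sobnorm (s' + 1) g \<le> R" "sobnorm s' h \<le> R" for s' x g h
  proof -
    have "\<bar>\<Sum>k\<in>A. transport_form s' x g h k\<bar> \<le> (\<Sum>k\<in>A. \<bar>transport_form s' x g h k\<bar>)" by (rule sum_abs)
    also have "\<dots> \<le> C * sobnorm p x * sobnorm (s' + 1) g * sobnorm s' h"
      using that A by (intro transport_form_sum_le) auto
    also have "\<dots> \<le> C * R * R * R" using that C0 R0 by (intro mult_mono) auto
    finally show ?thesis .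
  qed
  let ?t = "\<lambda>s u g h. \<Sum>k\<in>A. transport_form s u g h k" and ?B = "C * R * R * R"
  have W: "\<bar>?t s u (component w c) (component w c)\<bar> \<le> ?B" "\<bar>?t s z (component v c) (component w c)\<bar> \<le> ?B" for c
    using R C s u z sobsq_component[OF fin(1)] sobsq_component[OF fin(2)] sobsq_component[OF ws]
      order_trans[OF sobnorm_component_le[OF fin(1)] R(3)] order_trans[OF sobnorm_component_le[OF fin(2)] R(4)]
      order_trans[OF sobnorm_component_le[OF ws] Rs(1)]
    by (auto intro!: gen)
  have E: "\<bar>?t \<sigma> u \<eta> \<eta>\<bar> \<le> ?B" "\<bar>?t \<sigma> z \<theta> \<eta>\<bar> \<le> ?B"
    using R C s u z fin \<eta>s Rs by (auto intro!: gen)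
  have "(\<Sum>k\<in>A. energy_flux s \<sigma> u z v \<theta> w \<eta> k) =
      - 2 * (\<Sum>c\<in>UNIV. ?t s u (component w c) (component w c) + ?t s z (component v c) (component w c))
      - 2 * (?t \<sigma> u \<eta> \<eta> + ?t \<sigma> z \<theta> \<eta>)"
    unfolding energy_flux_def
    by (simp add: sum_subtractf sum.distrib sum_negf sum.swap[of _ A UNIV] flip: sum_distrib_left)
  moreover have "\<bar>\<Sum>c\<in>UNIV. ?t s u (component w c) (component w c) + ?t s z (component v c) (component w c)\<bar>
      \<le> (\<Sum>c\<in>(UNIV :: 3 set). 2 * ?B)"
  proof (intro order_trans[OF sum_abs] sum_mono)
    fix c :: 3
    show "\<bar>?t s u (component w c) (component w c) + ?t s z (component v c) (component w c)\<bar> \<le> 2 * ?B"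
      using W[of c] by linarith
  qed
  ultimately show ?thesis using E by simp
qed

section \<open>A Gronwall argument for truncated energies\<close>

text \<open>As \<open>Y\<close> is merely integrable, the inequality is iterated instead of
  differentiated: \<open>n\<close> substitutions starting from the bound \<open>M\<close> leave the
  remainder \<open>M * ((K * t) ^ n / fact n)\<close>, which tends to 0.\<close>

lemma integral_gronwall:
  fixes Y :: "real \<Rightarrow> real"
  assumes int: "Y integrable_on {0..T}" and nn: "0 \<le> a" "0 \<le> K" "0 \<le> M"
    and bnd: "\<And>t. t \<in> {0..T} \<Longrightarrow> Y t \<le> M"
    and ineq: "\<And>t. t \<in> {0..T} \<Longrightarrow> Y t \<le> a + K * integral {0..t} Y"
    and t: "t \<in> {0..T}"
  shows "Y t \<le> a * exp (K * t)"
proof -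
  have iter: "Y t \<le> a * exp (K * t) + M * ((K * t) ^ n / fact n)" if "t \<in> {0..T}" for n t
    using that
  proof (induction n arbitrary: t)
    case 0
    then show ?case using bnd[OF 0] nn by (simp add: add_increasing)
  next
    case (Suc n)
    let ?G = "\<lambda>s. a * exp (K * s) + M * ((K * s) ^ Suc n / fact (Suc n))"
    let ?g = "\<lambda>s. K * (a * exp (K * s) + M * ((K * s) ^ n / fact n))"
    have deriv: "(?G has_real_derivative ?g s) (at s within {0..t})" for s
    proof -
      have "((\<lambda>s. (K * s) ^ Suc n / fact (Suc n)) has_real_derivative
          real (Suc n) * (K * s) ^ n * K / fact (Suc n)) (at s within {0..t})"
        by (auto intro!: derivative_eq_intros simp del: of_nat_Suc fact_Suc power_Suc)
      then have "((\<lambda>s. (K * s) ^ Suc n / fact (Suc n)) has_real_derivative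
          K * ((K * s) ^ n / fact n)) (at s within {0..t})"
        unfolding fact_Suc by (simp del: of_nat_Suc add: mult.commute)
      moreover have "((\<lambda>s. exp (K * s)) has_real_derivative K * exp (K * s)) (at s within {0..t})"
        by (auto intro!: derivative_eq_intros)
      ultimately have "(?G has_real_derivative
          a * (K * exp (K * s)) + M * (K * ((K * s) ^ n / fact n))) (at s within {0..t})"
        by (intro DERIV_add DERIV_cmult)
      then show ?thesis by (simp add: algebra_simps)
    qed
    have G: "(?g has_integral ?G t - ?G 0) {0..t}"
      using Suc.prems deriv
      by (intro fundamental_theorem_of_calculus)
        (auto simp: has_real_derivative_iff_has_vector_derivative)
    have Yint: "(\<lambda>s. K * Y s) integrable_on {0..t}"
      using integrable_on_cmult_left[OF integrable_subinterval_real[OF int, of 0 t], of K] Suc.prems by auto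
    have "K * integral {0..t} Y = integral {0..t} (\<lambda>s. K * Y s)" by simp
    also have "\<dots> \<le> ?G t - ?G 0"
    proof (rule has_integral_le[OF integrable_integral[OF Yint] G])
      fix s assume "s \<in> {0..t}"
      then show "K * Y s \<le> ?g s"
        using Suc.IH[of s] Suc.prems nn(2) by (intro mult_left_mono) auto
    qed
    finally show ?case using ineq[OF Suc.prems] by simp
  qed
  have "(\<lambda>n. (K * t) ^ n / fact n) \<longlonglongrightarrow> 0"
    using summable_LIMSEQ_zero[OF summable_exp[of "K * t"]] by (simp add: field_simps)
  then have "(\<lambda>n. a * exp (K * t) + M * ((K * t) ^ n / fact n)) \<longlonglongrightarrow> a * exp (K * t) + M * 0"
    by (intro tendsto_intros)
  then show ?thesis
    using LIMSEQ_le_const[of _ _ "Y t"] iter[OF t] by force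
qed

lemma gronwall_truncated:
  fixes y d g :: "nat \<Rightarrow> real \<Rightarrow> real" and Y G :: "real \<Rightarrow> real"
  assumes K: "0 \<le> K" and T: "0 \<le> T"
    and ineq: "\<And>N t. t \<in> {0..T} \<Longrightarrow> y N t + integral {0..t} (d N) \<le> y N 0 + integral {0..t} (g N)"
    and d: "\<And>N. d N integrable_on {0..T}" "\<And>N N' t. N \<le> N' \<Longrightarrow> d N t \<le> d N' t" "\<And>N t. 0 \<le> d N t"
    and y: "\<And>N. y N integrable_on {0..T}" "\<And>N N' t. N \<le> N' \<Longrightarrow> y N t \<le> y N' t" "\<And>N t. 0 \<le> y N t"
      "\<And>N t. t \<in> {0..T} \<Longrightarrow> y N t \<le> M" "\<And>t. t \<in> {0..T} \<Longrightarrow> (\<lambda>N. y N t) \<longlonglongrightarrow> Y t"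
    and g: "\<And>N. g N integrable_on {0..T}" "\<And>N t. t \<in> {0..T} \<Longrightarrow> \<bar>g N t\<bar> \<le> L"
      "\<And>t. t \<in> {0..T} \<Longrightarrow> (\<lambda>N. g N t) \<longlonglongrightarrow> G t"
    and G: "\<And>t. t \<in> {0..T} \<Longrightarrow> G t \<le> K * Y t"
  shows "t \<in> {0..T} \<Longrightarrow> Y t \<le> Y 0 * exp (K * t)"
    and "integral {0..T} (d N) \<le> Y 0 * exp (K * T)"
proof -
  have sub: "f integrable_on {0..t}" if "f integrable_on {0..T}" "t \<in> {0..T}" for f :: "real \<Rightarrow> real" and t
    using integrable_subinterval_real[OF that(1), of 0 t] that(2) by auto
  have Y0: "0 \<le> Y t" if "t \<in> {0..T}" for t
    using LIMSEQ_le_const[OF y(5)[OF that]] y(3) by blast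
  have YM: "Y t \<le> M" if "t \<in> {0..T}" for t
    using LIMSEQ_le_const2[OF y(5)[OF that]] y(4)[OF that] by blast
  have Yint: "Y integrable_on {0..T}"
    by (rule dominated_convergence(1)[where f=y and h="\<lambda>_. M"]) (use y in auto)
  have main: "y N t + integral {0..t} (d N) \<le> Y 0 + K * integral {0..t} Y" if t: "t \<in> {0..T}" for N t
  proof -
    have Gint: "G integrable_on {0..t}" "(\<lambda>N. integral {0..t} (g N)) \<longlonglongrightarrow> integral {0..t} G"
      using dominated_convergence[where f=g and h="\<lambda>_. L" and S="{0..t}" and g=G] g t sub by auto
    have lim: "(\<lambda>N. y N 0 + integral {0..t} (g N)) \<longlonglongrightarrow> Y 0 + integral {0..t} G"
      using T by (intro tendsto_add y(5) Gint(2)) auto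
    \<comment> \<open>The index \<open>N\<close> stays fixed on the left while \<open>N'\<close>
      tends to infinity on the right; monotonicity in the truncation permits this and avoids a limit
      of the dissipation.\<close>
    have "y N t + integral {0..t} (d N) \<le> y N' 0 + integral {0..t} (g N')" if "N \<le> N'" for N'
    proof -
      have "integral {0..t} (d N) \<le> integral {0..t} (d N')"
        by (intro integral_le sub[OF d(1) t] d(2) that)
      then show ?thesis using y(2)[OF that, of t] ineq[OF t, of N'] by linarith
    qed
    then have "y N t + integral {0..t} (d N) \<le> Y 0 + integral {0..t} G"
      using LIMSEQ_le_const[OF lim] by blast
    also have "integral {0..t} G \<le> integral {0..t} (\<lambda>s. K * Y s)"
      using t G integrable_on_cmult_left[OF sub[OF Yint t], of K] by (intro integral_le Gint) auto
    finally show ?thesis by simp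
  qed
  have dnn: "0 \<le> integral {0..t} (d N)" if "t \<in> {0..T}" for N t
    by (rule integral_nonneg[OF sub[OF d(1) that]]) (use d in auto)
  have le: "Y t \<le> Y 0 + K * integral {0..t} Y" if "t \<in> {0..T}" for t
  proof (rule LIMSEQ_le_const2[OF y(5)[OF that]])
    show "\<exists>N. \<forall>n\<ge>N. y n t \<le> Y 0 + K * integral {0..t} Y"
      using main[OF that] dnn[OF that] by (metis add_increasing2 order_refl order_trans)
  qed
  have T0: "0 \<in> {0..T}" "T \<in> {0..T}" using T by auto
  have M0: "0 \<le> M" using y(3)[of 0 0] y(4)[OF T0(1), of 0] by linarith
  show gron: "Y t \<le> Y 0 * exp (K * t)" if "t \<in> {0..T}" for t
    by (rule integral_gronwall[OF Yint Y0[OF T0(1)] K M0 YM le that])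
  \<comment> \<open>The Gronwall bound integrates exactly, and the subtracted \<open>Y 0\<close>
    cancels the initial energy in the bound for the dissipation.\<close>
  have ex: "((\<lambda>s. K * (Y 0 * exp (K * s))) has_integral Y 0 * exp (K * T) - Y 0 * exp (K * 0)) {0..T}"
    using T by (intro fundamental_theorem_of_calculus)
      (auto simp flip: has_real_derivative_iff_has_vector_derivative intro!: derivative_eq_intros)
  have "K * integral {0..T} Y = integral {0..T} (\<lambda>s. K * Y s)" by simp
  also have "\<dots> \<le> Y 0 * exp (K * T) - Y 0"
    using has_integral_le[OF integrable_integral[OF integrable_on_cmult_left[OF Yint, of K]] ex] K gron
    by (auto intro: mult_left_mono)
  finally show "integral {0..T} (d N) \<le> Y 0 * exp (K * T)"
    using main[OF T0(2), of N] y(3)[of N T] by linarith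
qed

section \<open>Evolution of the Fourier modes\<close>

text \<open>The part removed by the projection is parallel to \<open>kvec k\<close>, hence
  orthogonal to a divergence free \<open>w\<close>; as \<open>kvec k\<close> is real, the bilinear
  \<open>cdot\<close> detects this orthogonality.\<close>

lemma leray_inner:
  assumes "k \<noteq> 0" "cdot w (kvec k) = 0"
  shows "leray k f \<bullet> w = f \<bullet> w"
proof -
  have "(c *s kvec k) \<bullet> w = c \<bullet> cdot w (kvec k)" for c
    by (simp add: inner_vec_def cdot_def inner_sum_right kvec_def inner_complex_def algebra_simps
        sum.distrib sum_distrib_left)
  then show ?thesis using assms by (simp add: leray_def inner_diff_left)
qed

lemma linear_leray: "linear (leray k)"
proof (rule linearI)
  show "leray k (x + y) = leray k x + leray k y" for x y
    by (simp add: leray_def cdot_def vec_eq_iff sum.distrib algebra_simps add_divide_distrib)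
  show "leray k (c *\<^sub>R x) = c *\<^sub>R leray k x" for c x
  proof -
    have "cdot (c *\<^sub>R x) y = c *\<^sub>R cdot x y" for y by (simp add: cdot_def scaleR_sum_right)
    then show ?thesis
      by (simp add: leray_def vec_eq_iff scaleR_conv_of_real[where 'a=complex] algebra_simps)
  qed
qed

text \<open>Fundamental theorem of calculus. At \<open>t = 0\<close> the integral is over a null
  interval, which is how the integral equation fixes the initial value.\<close>

lemma has_vector_derivative_of_integral_eq:
  fixes f F :: "real \<Rightarrow> 'a::euclidean_space"
  assumes F: "continuous_on {0..T} F"
    and f: "\<And>t. t \<in> {0..T} \<Longrightarrow> (F has_integral (f t - f0)) {0..t}" and t: "t \<in> {0..T}"
  shows "(f has_vector_derivative F t) (at t within {0..T})" and "f 0 = f0"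
proof -
  have "f t = f0 + integral {0..t} F" if "t \<in> {0..T}" for t
    using integral_unique[OF f[OF that]] by simp
  moreover have "((\<lambda>t. f0 + integral {0..t} F) has_vector_derivative F t) (at t within {0..T})"
    using integral_has_vector_derivative[OF F t] by (auto intro!: derivative_eq_intros)
  ultimately show "(f has_vector_derivative F t) (at t within {0..T})"
    using has_vector_derivative_transform[OF t] by (metis (no_types, lifting))
  have "(F has_integral (f 0 - f0)) {0..0}" using f[of 0] t by auto
  then show "f 0 = f0" using has_integral_unique[OF _ has_integral_refl(2)[of F 0]] by fastforce
qed

text \<open>The orders \<open>s\<close> and \<open>\<sigma>\<close> are those of the differences,
  with the solutions one order higher. A single \<open>C\<close> serves four trilinear estimates:
  orders \<open>s\<close> and \<open>\<sigma>\<close> for plain transport, one less for the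
  commutators.\<close>

locale two_solutions =
  fixes \<nu> \<alpha> \<beta> s \<sigma> p T C :: real
    and v1 v2 :: "real \<Rightarrow> vfield" and \<theta>1 \<theta>2 :: "real \<Rightarrow> sfield"
    and v10 v20 :: vfield and \<theta>10 \<theta>20 :: sfield
  assumes nu: "0 < \<nu>" and T: "0 < T" and s: "1 \<le> s" and sg: "1 \<le> \<sigma>"
    and sg_eq: "\<sigma> = s - \<beta>" and p_eq: "p = s + 2 * \<alpha>"
    and conv: "conv_const s p C" "conv_const (s - 1) p C" "conv_const \<sigma> p C" "conv_const (\<sigma> - 1) p C"
    and sol: "is_sol \<nu> \<alpha> \<beta> T v1 \<theta>1 v10 \<theta>10" "is_sol \<nu> \<alpha> \<beta> T v2 \<theta>2 v20 \<theta>20"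
    and V: "\<And>t. t \<in> {0..T} \<Longrightarrow> inV (s + 1) (v1 t)" "\<And>t. t \<in> {0..T} \<Longrightarrow> inV (s + 1) (v2 t)"
    and H: "\<And>t. t \<in> {0..T} \<Longrightarrow> inH (\<sigma> + 1) (\<theta>1 t)" "\<And>t. t \<in> {0..T} \<Longrightarrow> inH (\<sigma> + 1) (\<theta>2 t)"
    and cont: "cont_in (s + 1) v1 T" "cont_in (s + 1) v2 T"
      "cont_in (\<sigma> + 1) \<theta>1 T" "cont_in (\<sigma> + 1) \<theta>2 T"
begin

definition w :: "real \<Rightarrow> vfield" where "w t = v1 t - v2 t"
definition \<eta> :: "real \<Rightarrow> sfield" where "\<eta> t = \<theta>1 t - \<theta>2 t"
definition u :: "real \<Rightarrow> vfield" where "u t = velocity \<alpha> (v2 t)"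
definition z :: "real \<Rightarrow> vfield" where "z t = velocity \<alpha> (w t)"

lemma fin_v:
  assumes "t \<in> {0..T}"
  shows "sobsq (s + 1) (v1 t) < \<infinity>" "sobsq (s + 1) (v2 t) < \<infinity>" "sobsq (s + 1) (w t) < \<infinity>"
  using V[OF assms] sobsq_finite_diff by (auto simp only: inV_def w_def)

lemma fin_th:
  assumes "t \<in> {0..T}"
  shows "sobsq (\<sigma> + 1) (\<theta>1 t) < \<infinity>" "sobsq (\<sigma> + 1) (\<theta>2 t) < \<infinity>" "sobsq (\<sigma> + 1) (\<eta> t) < \<infinity>"
  using H[OF assms] sobsq_finite_diff by (auto simp only: inH_def \<eta>_def)

lemma fin_w: "t \<in> {0..T} \<Longrightarrow> sobsq s (w t) < \<infinity>"
  by (rule sobsq_finite_mono[OF fin_v(3)]) auto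

lemma fin_eta: "t \<in> {0..T} \<Longrightarrow> sobsq \<sigma> (\<eta> t) < \<infinity>"
  by (rule sobsq_finite_mono[OF fin_th(3)]) auto

lemma cont_w: "cont_in (s + 1) w T" and cont_eta: "cont_in (\<sigma> + 1) \<eta> T"
  using cont_in_diff[OF cont(1,2) fin_v(1,2)] cont_in_diff[OF cont(3,4) fin_th(1,2)]
  by (simp_all add: w_def[abs_def] \<eta>_def[abs_def])

lemma velocity_p:
  "sobsq p (velocity \<alpha> f) = sobsq s f" "sobnorm p (velocity \<alpha> f) = sobnorm s f"
  "sobsq (p + 1) (velocity \<alpha> f) = sobsq (s + 1) f" "sobnorm (p + 1) (velocity \<alpha> f) = sobnorm (s + 1) f"
  by (simp_all add: sobsq_velocity sobnorm_velocity p_eq algebra_simps)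

lemma cont_velocity:
  assumes "cont_in (s + 1) f T" "\<And>t. t \<in> {0..T} \<Longrightarrow> sobsq (s + 1) (f t) < \<infinity>"
  shows "cont_in p (\<lambda>t. velocity \<alpha> (f t)) T"
  using cont_in_mono[OF assms, of s] by (intro cont_in_velocity) (simp add: p_eq)

lemma fin_velocity:
  assumes "sobsq (s + 1) f < \<infinity>" shows "sobsq p (velocity \<alpha> f) < \<infinity>"
  unfolding velocity_p by (rule sobsq_finite_mono[OF assms]) simp

lemma continuous_adv_vector:
  assumes f: "cont_in (s + 1) f T" "\<And>t. t \<in> {0..T} \<Longrightarrow> sobsq (s + 1) (f t) < \<infinity>"
    and g: "cont_in (s + 1) g T" "\<And>t. t \<in> {0..T} \<Longrightarrow> sobsq (s + 1) (g t) < \<infinity>" and k: "k \<noteq> 0"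
  shows "continuous_on {0..T} (\<lambda>t. adv_s (velocity \<alpha> (f t)) (component (g t) c) k)"
  by (rule continuous_on_adv_s[OF conv(1) _ k])
    (use s f g in \<open>auto intro: cont_velocity fin_velocity cont_in_component sobsq_component
      simp del: infinity_ennreal_def\<close>)

lemma continuous_adv_scalar:
  assumes f: "cont_in (s + 1) f T" "\<And>t. t \<in> {0..T} \<Longrightarrow> sobsq (s + 1) (f t) < \<infinity>"
    and g: "cont_in (\<sigma> + 1) g T" "\<And>t. t \<in> {0..T} \<Longrightarrow> sobsq (\<sigma> + 1) (g t) < \<infinity>" and k: "k \<noteq> 0"
  shows "continuous_on {0..T} (\<lambda>t. adv_s (velocity \<alpha> (f t)) (g t) k)"
  by (rule continuous_on_adv_s[OF conv(3) _ k])
    (use sg f g in \<open>auto intro: cont_velocity fin_velocity simp del: infinity_ennreal_def\<close>)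

lemma mode_v:
  assumes sol': "is_sol \<nu> \<alpha> \<beta> T v \<theta> v0 \<theta>0"
    and v: "cont_in (s + 1) v T" "\<And>t. t \<in> {0..T} \<Longrightarrow> sobsq (s + 1) (v t) < \<infinity>"
    and th: "cont_in (\<sigma> + 1) \<theta> T" "\<And>t. t \<in> {0..T} \<Longrightarrow> sobsq (\<sigma> + 1) (\<theta> t) < \<infinity>"
    and k: "k \<noteq> 0" and t: "t \<in> {0..T}"
  shows "((\<lambda>t. v t k) has_vector_derivative
      - Bop (velocity \<alpha> (v t)) (v t) k - complex_of_real (\<nu> * knorm k powr (2 * \<beta>)) *s v t k
        + leray k (\<theta> t k *s e3)) (at t within {0..T})"
    and "v 0 k = v0 k"
proof -
  let ?F = "\<lambda>t. - Bop (velocity \<alpha> (v t)) (v t) k - complex_of_real (\<nu> * knorm k powr (2 * \<beta>)) *s v t k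
        + leray k (\<theta> t k *s e3)"
  have leray_cont: "continuous_on {0..T} (\<lambda>t. leray k (f t))" if "continuous_on {0..T} f" for f :: "real \<Rightarrow> complex ^ 3"
    using linear_continuous_on_compose[OF that linear_leray] by simp
  have "continuous_on {0..T} (\<lambda>t. \<chi> c. adv_s (velocity \<alpha> (v t)) (component (v t) c) k)"
    by (intro continuous_on_vec_lambda continuous_adv_vector v k)
  moreover have "(\<chi> c. adv_s (velocity \<alpha> (v t)) (component (v t) c) k) = adv_v (velocity \<alpha> (v t)) (v t) k"
    if "t \<in> {0..T}" for t
    using adv_v_component[OF conv(1) velocity_0 fin_velocity[OF v(2)[OF that]] v(2)[OF that] _ k] s
    by (simp add: vec_eq_iff)
  ultimately have adv: "continuous_on {0..T} (\<lambda>t. adv_v (velocity \<alpha> (v t)) (v t) k)"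
    by (rule continuous_on_eq)
  have vk: "continuous_on {0..T} (\<lambda>t. v t k)" and thk: "continuous_on {0..T} (\<lambda>t. \<theta> t k)"
    using continuous_on_mode[OF v _ k] continuous_on_mode[OF th _ k] s sg by auto
  have smult: "c *s x = (\<chi> i. c * x $ i)" for c :: complex and x :: "complex ^ 3"
    by (simp add: vec_eq_iff)
  have "continuous_on {0..T} ?F"
    unfolding Bop_def
    by (intro continuous_intros leray_cont adv, unfold smult)
      (intro continuous_on_vec_lambda continuous_intros vk thk)+
  moreover have "(?F has_integral (v t k - v0 k)) {0..t}" if "t \<in> {0..T}" for t
    using sol' that k unfolding is_sol_def by blast
  ultimately show "((\<lambda>t. v t k) has_vector_derivative ?F t) (at t within {0..T})" and "v 0 k = v0 k"
    using has_vector_derivative_of_integral_eq[of T ?F "\<lambda>t. v t k" "v0 k" t] t by auto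
qed

lemma mode_theta:
  assumes sol': "is_sol \<nu> \<alpha> \<beta> T v \<theta> v0 \<theta>0"
    and v: "cont_in (s + 1) v T" "\<And>t. t \<in> {0..T} \<Longrightarrow> sobsq (s + 1) (v t) < \<infinity>"
    and th: "cont_in (\<sigma> + 1) \<theta> T" "\<And>t. t \<in> {0..T} \<Longrightarrow> sobsq (\<sigma> + 1) (\<theta> t) < \<infinity>"
    and k: "k \<noteq> 0" and t: "t \<in> {0..T}"
  shows "((\<lambda>t. \<theta> t k) has_vector_derivative - adv_s (velocity \<alpha> (v t)) (\<theta> t) k) (at t within {0..T})"
    and "\<theta> 0 k = \<theta>0 k"
proof -
  let ?F = "\<lambda>t. - adv_s (velocity \<alpha> (v t)) (\<theta> t) k"
  have "continuous_on {0..T} ?F"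
    by (intro continuous_intros continuous_adv_scalar v th k)
  moreover have "(?F has_integral (\<theta> t k - \<theta>0 k)) {0..t}" if "t \<in> {0..T}" for t
    using sol' that k unfolding is_sol_def by blast
  ultimately show "((\<lambda>t. \<theta> t k) has_vector_derivative ?F t) (at t within {0..T})" and "\<theta> 0 k = \<theta>0 k"
    using has_vector_derivative_of_integral_eq[of T ?F "\<lambda>t. \<theta> t k" "\<theta>0 k" t] t by auto
qed

text \<open>The equations fix initial modes only for \<open>k \<noteq> 0\<close>, which suffices
  because the weighted norms do not see the zero mode.\<close>

lemma initial_values:
  shows "sobnorm s (w 0) = sobnorm s (v10 - v20)" and "sobnorm \<sigma> (\<eta> 0) = sobnorm \<sigma> (\<theta>10 - \<theta>20)"
proof -
  have T0: "0 \<in> {0..T}" using T by simp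
  have "weighted s (w 0) k = weighted s (v10 - v20) k" for k
    using mode_v(2)[OF sol(1) cont(1) fin_v(1) cont(3) fin_th(1) _ T0, of k]
      mode_v(2)[OF sol(2) cont(2) fin_v(2) cont(4) fin_th(2) _ T0, of k]
    by (cases "k = 0") (simp_all add: weighted_def w_def)
  then show "sobnorm s (w 0) = sobnorm s (v10 - v20)" by (simp add: sobnorm_def sobsq_eq_SUP)
  have "weighted \<sigma> (\<eta> 0) k = weighted \<sigma> (\<theta>10 - \<theta>20) k" for k
    using mode_theta(2)[OF sol(1) cont(1) fin_v(1) cont(3) fin_th(1) _ T0, of k]
      mode_theta(2)[OF sol(2) cont(2) fin_v(2) cont(4) fin_th(2) _ T0, of k]
    by (cases "k = 0") (simp_all add: weighted_def \<eta>_def)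
  then show "sobnorm \<sigma> (\<eta> 0) = sobnorm \<sigma> (\<theta>10 - \<theta>20)" by (simp add: sobnorm_def sobsq_eq_SUP)
qed

section \<open>Time derivative of the energy density\<close>

abbreviation flux :: "real \<Rightarrow> freq \<Rightarrow> real" where
  "flux t \<equiv> energy_flux s \<sigma> (u t) (z t) (v1 t) (\<theta>1 t) (w t) (\<eta> t)"

definition density :: "real \<Rightarrow> freq \<Rightarrow> real" where
  "density t k = (weighted s (w t) k)\<^sup>2 + (weighted \<sigma> (\<eta> t) k)\<^sup>2"

definition density_rate :: "real \<Rightarrow> freq \<Rightarrow> real" where
  "density_rate t k = flux t k - 2 * \<nu> * (weighted (s + \<beta>) (w t) k)\<^sup>2
    + 2 * knorm k powr (2 * s) * ((\<eta> t k *s e3) \<bullet> w t k)"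

text \<open>The derivative \<open>F\<close> is left anonymous because only its product with
  \<open>w t k\<close> enters the energy. In that product the Leray projections disappear,
  \<open>w t k\<close> being divergence free.\<close>

lemma w_equation:
  assumes t: "t \<in> {0..T}" and k: "k \<noteq> 0"
  obtains F where "((\<lambda>t. w t k) has_vector_derivative F) (at t within {0..T})"
    and "F \<bullet> w t k = - (\<Sum>c\<in>UNIV. (adv_s (u t) (component (w t) c) k + adv_s (z t) (component (v1 t) c) k) \<bullet> component (w t) c k)
      - \<nu> * knorm k powr (2 * \<beta>) * (norm (w t k))\<^sup>2 + (\<eta> t k *s e3) \<bullet> w t k"
proof -
  let ?u1 = "velocity \<alpha> (v1 t)" and ?u2 = "velocity \<alpha> (v2 t)"
  let ?\<mu> = "complex_of_real (\<nu> * knorm k powr (2 * \<beta>))"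
  let ?F1 = "- Bop ?u1 (v1 t) k - ?\<mu> *s v1 t k + leray k (\<theta>1 t k *s e3)"
  let ?F2 = "- Bop ?u2 (v2 t) k - ?\<mu> *s v2 t k + leray k (\<theta>2 t k *s e3)"
  note fv = fin_v[OF t]
  have d: "((\<lambda>t. w t k) has_vector_derivative ?F1 - ?F2) (at t within {0..T})"
    using has_vector_derivative_diff[OF mode_v(1)[OF sol(1) cont(1) fin_v(1) cont(3) fin_th(1) k t]
      mode_v(1)[OF sol(2) cont(2) fin_v(2) cont(4) fin_th(2) k t]]
    by (simp add: w_def[abs_def])
  let ?A = "adv_v ?u1 (v1 t) k - adv_v ?u2 (v2 t) k"
  have F: "?F1 - ?F2 = - leray k ?A - ?\<mu> *s w t k + leray k (\<eta> t k *s e3)"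
  proof -
    have "leray k (\<eta> t k *s e3) = leray k (\<theta>1 t k *s e3) - leray k (\<theta>2 t k *s e3)"
      by (simp add: \<eta>_def vector_sub_rdistrib linear_diff[OF linear_leray])
    moreover have "?\<mu> *s w t k = ?\<mu> *s v1 t k - ?\<mu> *s v2 t k"
      by (simp add: w_def vec_eq_iff right_diff_distrib)
    ultimately show ?thesis by (simp add: Bop_def linear_diff[OF linear_leray])
  qed
  have div: "cdot (w t k) (kvec k) = 0"
    using V[OF t] by (simp add: inV_def w_def cdot_def left_diff_distrib sum_subtractf)
  have comps: "?A $ c = adv_s (u t) (component (w t) c) k + adv_s (z t) (component (v1 t) c) k" for c
  proof -
    have "?A $ c = adv_s ?u1 (component (v1 t) c) k - adv_s ?u2 (component (v2 t) c) k"
      using adv_v_component[OF conv(1) velocity_0 fin_velocity[OF fv(1)] fv(1) _ k]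
        adv_v_component[OF conv(1) velocity_0 fin_velocity[OF fv(2)] fv(2) _ k] s by simp
    also have "\<dots> = adv_s ?u2 (component (v1 t) c - component (v2 t) c) k + adv_s (?u1 - ?u2) (component (v1 t) c) k"
      by (rule adv_s_difference[OF conv(1) velocity_0 velocity_0 fin_velocity[OF fv(1)] fin_velocity[OF fv(2)]
        sobsq_component[OF fv(1)] sobsq_component[OF fv(2)] _ k]) (use s in simp)
    finally show ?thesis by (simp add: u_def z_def w_def component_diff velocity_diff)
  qed
  have "?A \<bullet> w t k = (\<Sum>c\<in>UNIV. (adv_s (u t) (component (w t) c) k + adv_s (z t) (component (v1 t) c) k) \<bullet> component (w t) c k)"
    unfolding inner_vec_def comps by (simp add: component_def)
  moreover have "(?\<mu> *s w t k) \<bullet> w t k = \<nu> * knorm k powr (2 * \<beta>) * (norm (w t k))\<^sup>2"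
  proof -
    have "?\<mu> *s w t k = (\<nu> * knorm k powr (2 * \<beta>)) *\<^sub>R w t k"
      by (simp add: vec_eq_iff scaleR_conv_of_real[where 'a=complex])
    then show ?thesis by (simp add: power2_norm_eq_inner)
  qed
  ultimately show ?thesis
    using that[OF d] unfolding F by (simp add: inner_diff_left inner_add_left leray_inner[OF k div])
qed

lemma eta_equation:
  assumes t: "t \<in> {0..T}" and k: "k \<noteq> 0"
  shows "((\<lambda>t. \<eta> t k) has_vector_derivative - (adv_s (u t) (\<eta> t) k + adv_s (z t) (\<theta>1 t) k)) (at t within {0..T})"
proof -
  note fv = fin_v[OF t] and fth = fin_th[OF t]
  have "adv_s (velocity \<alpha> (v1 t)) (\<theta>1 t) k - adv_s (velocity \<alpha> (v2 t)) (\<theta>2 t) k =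
      adv_s (u t) (\<eta> t) k + adv_s (z t) (\<theta>1 t) k"
    using adv_s_difference[OF conv(3) velocity_0 velocity_0 fin_velocity[OF fv(1)] fin_velocity[OF fv(2)] fth(1,2) _ k] sg
    by (simp add: u_def z_def w_def \<eta>_def velocity_diff)
  moreover have "((\<lambda>t. \<eta> t k) has_vector_derivative
      - adv_s (velocity \<alpha> (v1 t)) (\<theta>1 t) k - - adv_s (velocity \<alpha> (v2 t)) (\<theta>2 t) k) (at t within {0..T})"
    using has_vector_derivative_diff[OF mode_theta(1)[OF sol(1) cont(1) fin_v(1) cont(3) fin_th(1) k t]
      mode_theta(1)[OF sol(2) cont(2) fin_v(2) cont(4) fin_th(2) k t]]
    by (simp add: \<eta>_def[abs_def])
  ultimately show ?thesis by (simp add: algebra_simps)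
qed

lemma density_has_derivative:
  assumes t: "t \<in> {0..T}" and k: "k \<noteq> 0"
  shows "((\<lambda>t. density t k) has_vector_derivative density_rate t k) (at t within {0..T})"
proof -
  obtain F where F: "((\<lambda>t. w t k) has_vector_derivative F) (at t within {0..T})"
    and Fw: "F \<bullet> w t k = - (\<Sum>c\<in>UNIV. (adv_s (u t) (component (w t) c) k + adv_s (z t) (component (v1 t) c) k) \<bullet> component (w t) c k)
      - \<nu> * knorm k powr (2 * \<beta>) * (norm (w t k))\<^sup>2 + (\<eta> t k *s e3) \<bullet> w t k"
    using w_equation[OF t k] by blast
  let ?E = "- (adv_s (u t) (\<eta> t) k + adv_s (z t) (\<theta>1 t) k)"
  have sq: "((\<lambda>t. c * (f t \<bullet> f t)) has_vector_derivative c * (2 * (F \<bullet> f t))) (at t within {0..T})"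
    if "(f has_vector_derivative F) (at t within {0..T})" for c and f :: "real \<Rightarrow> 'b::real_inner" and F
  proof -
    have "((\<lambda>t. f t \<bullet> f t) has_vector_derivative f t \<bullet> F + F \<bullet> f t) (at t within {0..T})"
      by (rule bounded_bilinear.has_vector_derivative[OF bounded_bilinear_inner that that])
    then have "((\<lambda>t. c * (f t \<bullet> f t)) has_vector_derivative c * (f t \<bullet> F + F \<bullet> f t)) (at t within {0..T})"
      by (rule has_vector_derivative_mult_right)
    then show ?thesis by (simp add: inner_commute)
  qed
  have "(\<lambda>t. density t k) = (\<lambda>t. knorm k powr (2 * s) * (w t k \<bullet> w t k) + knorm k powr (2 * \<sigma>) * (\<eta> t k \<bullet> \<eta> t k))"
    by (simp add: density_def weighted_square power2_norm_eq_inner)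
  moreover have "((\<lambda>t. knorm k powr (2 * s) * (w t k \<bullet> w t k) + knorm k powr (2 * \<sigma>) * (\<eta> t k \<bullet> \<eta> t k))
    has_vector_derivative knorm k powr (2 * s) * (2 * (F \<bullet> w t k)) + knorm k powr (2 * \<sigma>) * (2 * (?E \<bullet> \<eta> t k)))
    (at t within {0..T})"
    by (intro has_vector_derivative_add sq[of "\<lambda>t. w t k"] sq[of "\<lambda>t. \<eta> t k"] F eta_equation t k)
  moreover have "knorm k powr (2 * s) * (2 * (F \<bullet> w t k)) + knorm k powr (2 * \<sigma>) * (2 * (?E \<bullet> \<eta> t k)) = density_rate t k"
  proof -
    have pw: "knorm k powr (2 * (s + \<beta>)) = knorm k powr (2 * s) * knorm k powr (2 * \<beta>)"
      by (simp add: distrib_left powr_add)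
    show ?thesis
      unfolding Fw density_rate_def energy_flux_def transport_form_def weighted_square pw
      by (simp add: inner_add_left sum.distrib sum_negf sum_distrib_left algebra_simps)
  qed
  ultimately show ?thesis by simp
qed

lemma density_rate_le:
  "density_rate t k \<le> flux t k + (1 / \<nu>) * (weighted \<sigma> (\<eta> t) k)\<^sup>2 - \<nu> * (weighted (s + \<beta>) (w t) k)\<^sup>2"
proof -
  let ?a = "weighted (s + \<beta>) (w t) k" and ?b = "weighted \<sigma> (\<eta> t) k"
  have "norm e3 = 1" by (simp add: e3_def)
  then have "(\<eta> t k *s e3) \<bullet> w t k \<le> norm (\<eta> t k) * norm (w t k)"
    using norm_cauchy_schwarz[of "\<eta> t k *s e3" "w t k"] by (simp add: norm_vector_smult)
  then have "knorm k powr (2 * s) * ((\<eta> t k *s e3) \<bullet> w t k) \<le> knorm k powr (2 * s) * (norm (\<eta> t k) * norm (w t k))"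
    by (intro mult_left_mono) auto
  also have "\<dots> = ?a * ?b"
    using powr_add[of "knorm k" "s + \<beta>" \<sigma>] by (simp add: weighted_def sg_eq)
  finally have 1: "2 * knorm k powr (2 * s) * ((\<eta> t k *s e3) \<bullet> w t k) \<le> 2 * (?a * ?b)" by simp
  \<comment> \<open>Young's inequality by completing the square: one of the two copies of the
    dissipation absorbs the buoyancy, the other survives, and the price \<open>1 / \<nu>\<close>
    reappears in \<open>growth\<close>.\<close>
  have "0 \<le> (\<nu> * ?a - ?b)\<^sup>2 / \<nu>" using nu by simp
  also have "\<dots> = \<nu> * ?a\<^sup>2 + (1 / \<nu>) * ?b\<^sup>2 - 2 * (?a * ?b)"
    using nu by (simp add: power2_eq_square field_simps)
  finally show ?thesis using 1 unfolding density_rate_def by linarith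
qed

end

section \<open>Stability\<close>

context two_solutions
begin

text \<open>A majorant for domination, which leaves no trace in the result; the rate of growth is
  built from \<open>transport_bound\<close>, which is free of \<open>\<theta>2\<close>.\<close>

definition bound :: real where
  "bound = Linfnorm (s + 1) v1 T + Linfnorm (s + 1) v2 T + Linfnorm (\<sigma> + 1) \<theta>1 T + Linfnorm (\<sigma> + 1) \<theta>2 T"

definition transport_bound :: real where
  "transport_bound = Linfnorm (s + 1) v1 T + Linfnorm (s + 1) v2 T + Linfnorm (\<sigma> + 1) \<theta>1 T"

lemma Linfnorm_bounds:
  assumes t: "t \<in> {0..T}"
  shows "sobnorm (s + 1) (v1 t) \<le> Linfnorm (s + 1) v1 T" "sobnorm (s + 1) (v2 t) \<le> Linfnorm (s + 1) v2 T"
    "sobnorm (\<sigma> + 1) (\<theta>1 t) \<le> Linfnorm (\<sigma> + 1) \<theta>1 T" "sobnorm (\<sigma> + 1) (\<theta>2 t) \<le> Linfnorm (\<sigma> + 1) \<theta>2 T"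
    "0 \<le> Linfnorm (s + 1) v1 T" "0 \<le> Linfnorm (s + 1) v2 T"
    "0 \<le> Linfnorm (\<sigma> + 1) \<theta>1 T" "0 \<le> Linfnorm (\<sigma> + 1) \<theta>2 T"
proof -
  show *: "sobnorm (s + 1) (v1 t) \<le> Linfnorm (s + 1) v1 T" "sobnorm (s + 1) (v2 t) \<le> Linfnorm (s + 1) v2 T"
    "sobnorm (\<sigma> + 1) (\<theta>1 t) \<le> Linfnorm (\<sigma> + 1) \<theta>1 T" "sobnorm (\<sigma> + 1) (\<theta>2 t) \<le> Linfnorm (\<sigma> + 1) \<theta>2 T"
    using sobnorm_le_Linfnorm[OF cont(1) fin_v(1) t] sobnorm_le_Linfnorm[OF cont(2) fin_v(2) t]
      sobnorm_le_Linfnorm[OF cont(3) fin_th(1) t] sobnorm_le_Linfnorm[OF cont(4) fin_th(2) t] by blast+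
  show "0 \<le> Linfnorm (s + 1) v1 T" "0 \<le> Linfnorm (s + 1) v2 T"
    "0 \<le> Linfnorm (\<sigma> + 1) \<theta>1 T" "0 \<le> Linfnorm (\<sigma> + 1) \<theta>2 T"
    using * sobnorm_nonneg order_trans by blast+
qed

lemma norms_le_bound:
  assumes t: "t \<in> {0..T}"
  shows "sobnorm (s + 1) (w t) \<le> bound" "sobnorm (\<sigma> + 1) (\<eta> t) \<le> bound"
    "sobnorm s (w t) \<le> bound" "sobnorm \<sigma> (\<eta> t) \<le> bound"
    "sobnorm (s + 1) (v1 t) \<le> bound" "sobnorm (\<sigma> + 1) (\<theta>1 t) \<le> bound"
    "sobnorm p (u t) \<le> bound" "sobnorm p (z t) \<le> bound" "0 \<le> bound"
proof -
  note L = Linfnorm_bounds[OF t]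
  show 1: "sobnorm (s + 1) (w t) \<le> bound"
    unfolding w_def bound_def using sobnorm_diff_le[OF fin_v(1,2)[OF t]] L by linarith
  show 2: "sobnorm (\<sigma> + 1) (\<eta> t) \<le> bound"
    unfolding \<eta>_def bound_def using sobnorm_diff_le[OF fin_th(1,2)[OF t]] L by linarith
  show 3: "sobnorm s (w t) \<le> bound"
    using sobnorm_mono[OF fin_v(3)[OF t], of s] 1 by simp
  show "sobnorm \<sigma> (\<eta> t) \<le> bound"
    using sobnorm_mono[OF fin_th(3)[OF t], of \<sigma>] 2 by simp
  show "sobnorm (s + 1) (v1 t) \<le> bound" "sobnorm (\<sigma> + 1) (\<theta>1 t) \<le> bound" "0 \<le> bound"
    using L by (simp_all add: bound_def)
  have "sobnorm s (v2 t) \<le> sobnorm (s + 1) (v2 t)"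
    by (rule sobnorm_mono[OF fin_v(2)[OF t]]) simp
  then show "sobnorm p (u t) \<le> bound"
    using L by (simp add: u_def velocity_p bound_def)
  show "sobnorm p (z t) \<le> bound" using 3 by (simp add: z_def velocity_p)
qed

lemma flux_sum_le:
  assumes t: "t \<in> {0..T}" and A: "finite A"
  shows "\<bar>\<Sum>k\<in>A. flux t k\<bar> \<le> 16 * (C * bound * bound * bound)"
proof (rule energy_flux_sum_le[OF conv(1,3) _ _ _ _ _ _ fin_v(1,3)[OF t] fin_th(1,3)[OF t] _ _ _ _ _ _ A])
  show "sobsq p (u t) < \<infinity>" "sobsq p (z t) < \<infinity>"
    unfolding u_def z_def by (intro fin_velocity fin_v t)+
qed (use norms_le_bound[OF t] s sg in \<open>auto simp: u_def z_def\<close>)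

lemma flux_tendsto:
  assumes t: "t \<in> {0..T}"
  obtains S where "(\<lambda>N. \<Sum>k\<in>freq_box N. flux t k) \<longlonglongrightarrow> S"
    and "S \<le> C * transport_bound * (12 * s + 4 * \<sigma> + 8) * ((sobnorm s (w t))\<^sup>2 + (sobnorm \<sigma> (\<eta> t))\<^sup>2)"
proof (rule energy_flux_tendsto[OF conv s sg _ _ _ _ _ _ fin_v(1,3)[OF t] fin_th(1,3)[OF t]])
  show "u t (- k) = vcnj (u t k)" "cdot (u t k) (kvec k) = 0" for k
    using V(2)[OF t] by (simp_all add: u_def inV_def velocity_real velocity_div_free)
  show "sobsq (p + 1) (u t) < \<infinity>"
    unfolding u_def velocity_p by (rule fin_v[OF t])
  show "sobsq p (z t) < \<infinity>" unfolding z_def by (intro fin_velocity fin_v t)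
  show "sobnorm p (z t) \<le> sobnorm s (w t)" by (simp add: z_def velocity_p)
  show "sobnorm (p + 1) (u t) \<le> transport_bound" "sobnorm (s + 1) (v1 t) \<le> transport_bound"
    "sobnorm (\<sigma> + 1) (\<theta>1 t) \<le> transport_bound"
    using Linfnorm_bounds[OF t] by (simp_all add: transport_bound_def u_def velocity_p)
qed (use that in \<open>auto simp: u_def z_def\<close>)

lemma continuous_weighted:
  assumes "k \<noteq> 0"
  shows "continuous_on {0..T} (\<lambda>t. (weighted q (w t) k)\<^sup>2)" "continuous_on {0..T} (\<lambda>t. (weighted q (\<eta> t) k)\<^sup>2)"
  unfolding weighted_def
  using continuous_on_mode[OF cont_w fin_v(3) _ assms] continuous_on_mode[OF cont_eta fin_th(3) _ assms] s sg
  by (auto intro!: continuous_intros)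

lemma continuous_flux:
  assumes k: "k \<noteq> 0"
  shows "continuous_on {0..T} (\<lambda>t. flux t k)"
proof -
  have w: "continuous_on {0..T} (\<lambda>t. component (w t) c k)" for c
    by (rule continuous_on_mode[OF cont_in_component[OF cont_w fin_v(3)] sobsq_component[OF fin_v(3)] _ k])
      (use s in auto)
  have e: "continuous_on {0..T} (\<lambda>t. \<eta> t k)"
    using continuous_on_mode[OF cont_eta fin_th(3) _ k] sg by simp
  show ?thesis
    unfolding energy_flux_def transport_form_def u_def z_def
    by (intro continuous_intros continuous_adv_vector continuous_adv_scalar w e k cont cont_w cont_eta fin_v fin_th)
qed

definition growth :: real where
  "growth = C * transport_bound * (12 * s + 4 * \<sigma> + 8) + 1 / \<nu>"

definition energy :: "real \<Rightarrow> real" where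
  "energy t = (sobnorm s (w t))\<^sup>2 + (sobnorm \<sigma> (\<eta> t))\<^sup>2"

lemma growth_nonneg: "0 \<le> growth"
  unfolding growth_def transport_bound_def
  using conv_const_nonneg[OF conv(1)] Linfnorm_bounds[of 0] T s sg nu
  by (intro add_nonneg_nonneg mult_nonneg_nonneg) auto

lemma density_sum_tendsto:
  assumes "t \<in> {0..T}"
  shows "(\<lambda>N. \<Sum>k\<in>freq_box N. density t k) \<longlonglongrightarrow> energy t"
    and "(\<Sum>k\<in>freq_box N. density t k) \<le> energy t"
proof -
  show lim: "(\<lambda>N. \<Sum>k\<in>freq_box N. density t k) \<longlonglongrightarrow> energy t"
    unfolding density_def energy_def sum.distrib
    by (intro tendsto_add weighted_square_sum_tendsto fin_w fin_eta assms)
  show "(\<Sum>k\<in>freq_box N. density t k) \<le> energy t"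
    by (rule incseq_le[OF _ lim])
      (auto simp: incseq_def density_def intro!: sum_mono2 dest: freq_box_mono)
qed

text \<open>\<open>density_rate_le\<close> summed over a box and integrated in time. The flux is
  kept as it stands, since its comparison with the energy waits for the sum over all modes.\<close>

lemma truncated_energy_inequality:
  assumes t: "t \<in> {0..T}"
  shows "(\<Sum>k\<in>freq_box N. density t k) +
      integral {0..t} (\<lambda>t. \<nu> * (\<Sum>k\<in>freq_box N. (weighted (s + \<beta>) (w t) k)\<^sup>2))
    \<le> (\<Sum>k\<in>freq_box N. density 0 k) +
      integral {0..t} (\<lambda>t. \<Sum>k\<in>freq_box N. flux t k + (1 / \<nu>) * (weighted \<sigma> (\<eta> t) k)\<^sup>2)"
    (is "?y t + integral {0..t} ?d \<le> ?y 0 + integral {0..t} ?g")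
proof -
  have nz: "k \<in> freq_box N \<Longrightarrow> k \<noteq> 0" for k by auto
  have sub: "{0..t} \<subseteq> {0..T}" using t by auto
  have d: "?d integrable_on {0..t}" and g: "?g integrable_on {0..t}"
    by (intro integrable_continuous_real continuous_on_subset[OF _ sub] continuous_intros
        continuous_weighted continuous_flux nz; assumption)+
  have "((\<lambda>t. ?y t) has_vector_derivative (\<Sum>k\<in>freq_box N. density_rate x k)) (at x within {0..t})"
    if "x \<in> {0..t}" for x
    using that sub
    by (intro has_vector_derivative_sum has_vector_derivative_within_subset[OF density_has_derivative[OF _ nz] sub]) auto
  then have "((\<lambda>x. \<Sum>k\<in>freq_box N. density_rate x k) has_integral ?y t - ?y 0) {0..t}"
    using t by (intro fundamental_theorem_of_calculus) auto
  then have "?y t - ?y 0 \<le> integral {0..t} (\<lambda>x. ?g x - ?d x)"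
  proof (rule has_integral_le[OF _ integrable_integral[OF integrable_diff[OF g d]]])
    fix x
    show "(\<Sum>k\<in>freq_box N. density_rate x k) \<le> ?g x - ?d x"
      unfolding sum_distrib_left sum_subtractf[symmetric]
      by (intro sum_mono density_rate_le)
  qed
  then show ?thesis using integral_diff[OF g d] by simp
qed

lemma energy_estimate:
  shows "t \<in> {0..T} \<Longrightarrow> energy t \<le> energy 0 * exp (growth * t)"
    and "integral {0..T} (\<lambda>t. \<nu> * (\<Sum>k\<in>freq_box N. (weighted (s + \<beta>) (w t) k)\<^sup>2)) \<le> energy 0 * exp (growth * T)"
proof -
  \<comment> \<open>Choice assembles the limits at individual times into a function; its
    integrability is inherited from dominated convergence in
    \<open>gronwall_truncated\<close>.\<close>
  have "\<exists>S. \<forall>t\<in>{0..T}. (\<lambda>N. \<Sum>k\<in>freq_box N. flux t k) \<longlonglongrightarrow> S t \<and>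
      S t \<le> C * transport_bound * (12 * s + 4 * \<sigma> + 8) * energy t"
    unfolding energy_def by (rule bchoice) (use flux_tendsto in blast)
  then obtain S where S: "\<And>t. t \<in> {0..T} \<Longrightarrow> (\<lambda>N. \<Sum>k\<in>freq_box N. flux t k) \<longlonglongrightarrow> S t"
      "\<And>t. t \<in> {0..T} \<Longrightarrow> S t \<le> C * transport_bound * (12 * s + 4 * \<sigma> + 8) * energy t" by blast
  let ?y = "\<lambda>N t. \<Sum>k\<in>freq_box N. density t k"
  let ?d = "\<lambda>N t. \<nu> * (\<Sum>k\<in>freq_box N. (weighted (s + \<beta>) (w t) k)\<^sup>2)"
  let ?g = "\<lambda>N t. \<Sum>k\<in>freq_box N. flux t k + (1 / \<nu>) * (weighted \<sigma> (\<eta> t) k)\<^sup>2"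
  let ?G = "\<lambda>t. S t + (1 / \<nu>) * (sobnorm \<sigma> (\<eta> t))\<^sup>2"
  have nz: "k \<in> freq_box N \<Longrightarrow> k \<noteq> 0" for k N by auto
  have int: "?d N integrable_on {0..T}" "?g N integrable_on {0..T}" "?y N integrable_on {0..T}" for N
    unfolding density_def
    by (intro integrable_continuous_real continuous_intros continuous_weighted continuous_flux nz; assumption)+
  have eb: "energy t \<le> bound\<^sup>2 + bound\<^sup>2" "(sobnorm \<sigma> (\<eta> t))\<^sup>2 \<le> bound\<^sup>2" if "t \<in> {0..T}" for t
    unfolding energy_def using norms_le_bound[OF that] by (intro add_mono power_mono; simp)+
  have wb: "(\<Sum>k\<in>freq_box N. (weighted \<sigma> (\<eta> t) k)\<^sup>2) \<le> (sobnorm \<sigma> (\<eta> t))\<^sup>2" if "t \<in> {0..T}" for N t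
    by (rule incseq_le[OF _ weighted_square_sum_tendsto[OF fin_eta[OF that]]])
      (auto simp: incseq_def intro!: sum_mono2 dest: freq_box_mono)
  have split: "?g N t = (\<Sum>k\<in>freq_box N. flux t k) + (1 / \<nu>) * (\<Sum>k\<in>freq_box N. (weighted \<sigma> (\<eta> t) k)\<^sup>2)" for N t
    by (simp only: sum.distrib sum_distrib_left)
  have gl: "\<bar>?g N t\<bar> \<le> 16 * (C * bound * bound * bound) + (1 / \<nu>) * bound\<^sup>2" if "t \<in> {0..T}" for N t
  proof -
    have "\<bar>(1 / \<nu>) * (\<Sum>k\<in>freq_box N. (weighted \<sigma> (\<eta> t) k)\<^sup>2)\<bar> \<le> (1 / \<nu>) * bound\<^sup>2"
      unfolding abs_mult
      by (intro mult_mono) (use nu wb[OF that, of N] eb(2)[OF that] in \<open>auto simp: sum_nonneg abs_of_nonneg\<close>)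
    then show ?thesis unfolding split using flux_sum_le[OF that finite_freq_box, of N] by linarith
  qed
  have glim: "(\<lambda>N. ?g N t) \<longlonglongrightarrow> ?G t" if "t \<in> {0..T}" for t
    unfolding split by (intro tendsto_intros S(1) weighted_square_sum_tendsto fin_eta that)
  have G: "?G t \<le> growth * energy t" if "t \<in> {0..T}" for t
  proof -
    have "(1 / \<nu>) * (sobnorm \<sigma> (\<eta> t))\<^sup>2 \<le> (1 / \<nu>) * energy t"
      using nu by (intro mult_left_mono) (auto simp: energy_def)
    then show ?thesis using S(2)[OF that] unfolding growth_def by (simp add: distrib_right)
  qed
  have ybound: "?y N t \<le> bound\<^sup>2 + bound\<^sup>2" if "t \<in> {0..T}" for N t
    using density_sum_tendsto(2)[OF that] eb(1)[OF that] order_trans by blast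
  have mono: "N \<le> N' \<Longrightarrow> ?d N t \<le> ?d N' t" "N \<le> N' \<Longrightarrow> ?y N t \<le> ?y N' t" for N N' t
    using nu by (auto simp: density_def intro!: mult_left_mono sum_mono2 dest: freq_box_mono)
  have nonneg: "0 \<le> ?d N t" "0 \<le> ?y N t" for N t
    using nu by (auto simp: density_def sum_nonneg)
  note gron = gronwall_truncated[OF growth_nonneg less_imp_le[OF T] truncated_energy_inequality int(1) mono(1) nonneg(1)
      int(3) mono(2) nonneg(2) ybound density_sum_tendsto(1) int(2) gl glim G]
  show "t \<in> {0..T} \<Longrightarrow> energy t \<le> energy 0 * exp (growth * t)" by (rule gron(1))
  show "integral {0..T} (?d N) \<le> energy 0 * exp (growth * T)" by (rule gron(2))
qed

text \<open>The bound on the truncated dissipation is uniform in the truncation, so monotone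
  convergence transfers it to the full norm.\<close>

lemma dissipation_estimate:
  "L2norm (s + \<beta>) w T \<le> sqrt (energy 0 * exp (growth * T) / \<nu>)"
proof -
  let ?f = "\<lambda>N t. \<Sum>k\<in>freq_box N. (weighted (s + \<beta>) (w t) k)\<^sup>2"
  have nz: "k \<in> freq_box N \<Longrightarrow> k \<noteq> 0" for k N by auto
  have contf: "continuous_on {0..T} (?f N)" for N
    by (intro continuous_intros continuous_weighted nz)
  let ?B = "energy 0 * exp (growth * T) / \<nu>"
  have e0: "0 \<le> energy 0" by (simp add: energy_def)
  have B0: "0 \<le> ?B" using e0 nu by simp
  have each: "(\<integral>\<^sup>+ t\<in>{0..T}. ennreal (?f N t) \<partial>lborel) \<le> ennreal ?B" for N
  proof -
    have hi: "(?f N has_integral integral {0..T} (?f N)) {0..T}"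
      by (intro integrable_integral integrable_continuous_real contf)
    have "(\<integral>\<^sup>+ t\<in>{0..T}. ennreal (?f N t) \<partial>lborel) = ennreal (integral {0..T} (?f N))"
      by (rule nn_integral_has_integral_lebesgue'[OF _ hi]) (simp add: sum_nonneg)
    also have "\<dots> \<le> ennreal ?B"
      using energy_estimate(2)[of N] nu by (intro ennreal_leI) (simp add: field_simps)
    finally show ?thesis .
  qed
  have "(\<integral>\<^sup>+ t\<in>{0..T}. sobsq (s + \<beta>) (w t) \<partial>lborel) =
      (\<integral>\<^sup>+ t. (SUP N. ennreal (?f N t) * indicator {0..T} t) \<partial>lborel)"
    by (simp add: sobsq_eq_SUP SUP_mult_right_ennreal)
  also have "\<dots> = (SUP N. \<integral>\<^sup>+ t\<in>{0..T}. ennreal (?f N t) \<partial>lborel)"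
  proof (rule nn_integral_monotone_convergence_SUP)
    show "incseq (\<lambda>N t. ennreal (?f N t) * indicator {0..T} t)"
      by (auto simp: incseq_def le_fun_def intro!: mult_right_mono ennreal_leI sum_mono2 dest: freq_box_mono)
    show "(\<lambda>t. ennreal (?f N t) * indicator {0..T} t) \<in> borel_measurable lborel" for N
    proof -
      \<comment> \<open>The truncated sums are known to be continuous only on \<open>{0..T}\<close>,
        so measurability is obtained for the product with the indicator.\<close>
      have "(\<lambda>t. indicator {0..T} t *\<^sub>R ?f N t) \<in> borel_measurable borel"
        by (rule borel_measurable_continuous_on_indicator[OF _ contf]) simp
      then have "(\<lambda>t. ennreal (indicator {0..T} t *\<^sub>R ?f N t)) \<in> borel_measurable borel" by measurable
      also have "(\<lambda>t. ennreal (indicator {0..T} t *\<^sub>R ?f N t)) = (\<lambda>t. ennreal (?f N t) * indicator {0..T} t)"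
        by (auto simp: indicator_def)
      finally show ?thesis by simp
    qed
  qed
  also have "\<dots> \<le> ennreal ?B" by (intro SUP_least each)
  finally have "enn2real (\<integral>\<^sup>+ t\<in>{0..T}. sobsq (s + \<beta>) (w t) \<partial>lborel) \<le> ?B"
    using B0 by (simp add: enn2real_leI)
  then show ?thesis unfolding L2norm_def by (rule real_sqrt_le_mono)
qed

text \<open>Each supremum norm is at most the largest square root of the energy, and the dissipation
  norm costs a further \<open>sqrt (1 / \<nu>)\<close>; this gives the factor
  \<open>2 + sqrt (1 / \<nu>)\<close>.\<close>

lemma stability:
  "Linfnorm s w T + L2norm (s + \<beta>) w T + Linfnorm \<sigma> \<eta> T
    \<le> (2 + sqrt (1 / \<nu>)) * sqrt (exp (growth * T)) *
      (sobnorm s (v10 - v20) + sobnorm \<sigma> (\<theta>10 - \<theta>20))"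
proof -
  let ?E = "sqrt (exp (growth * T))" and ?I = "sobnorm s (v10 - v20) + sobnorm \<sigma> (\<theta>10 - \<theta>20)"
  have e0: "0 \<le> energy 0" by (simp add: energy_def)
  have init: "sqrt (energy 0) \<le> ?I"
    unfolding energy_def initial_values by (rule sqrt_sum_squares_le_sum) auto
  have en: "sqrt (energy t) \<le> ?E * ?I" if t: "t \<in> {0..T}" for t
  proof -
    have "energy t \<le> energy 0 * exp (growth * t)" by (rule energy_estimate(1)[OF t])
    also have "\<dots> \<le> energy 0 * exp (growth * T)"
      using t growth_nonneg e0 by (intro mult_left_mono) (auto intro: mult_left_mono)
    finally have "sqrt (energy t) \<le> sqrt (energy 0) * ?E"
      by (simp flip: real_sqrt_mult)
    also have "\<dots> \<le> ?I * ?E" by (intro mult_right_mono init) simp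
    finally show ?thesis by (simp add: mult.commute)
  qed
  have ne: "{0..T} \<noteq> {}" using T by simp
  have "sobnorm s (w t) \<le> sqrt (energy t)" "sobnorm \<sigma> (\<eta> t) \<le> sqrt (energy t)" for t
    unfolding energy_def by (simp_all add: real_le_rsqrt)
  then have "sobnorm s (w t) \<le> ?E * ?I" "sobnorm \<sigma> (\<eta> t) \<le> ?E * ?I" if "t \<in> {0..T}" for t
    using en[OF that] order_trans by blast+
  then have "Linfnorm s w T \<le> ?E * ?I" "Linfnorm \<sigma> \<eta> T \<le> ?E * ?I"
    unfolding Linfnorm_def by (intro cSUP_least ne; simp)+
  moreover have "L2norm (s + \<beta>) w T \<le> sqrt (1 / \<nu>) * (?E * ?I)"
  proof -
    have "L2norm (s + \<beta>) w T \<le> sqrt (1 / \<nu>) * (?E * sqrt (energy 0))"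
      using dissipation_estimate by (simp add: real_sqrt_mult real_sqrt_divide mult_ac)
    also have "\<dots> \<le> sqrt (1 / \<nu>) * (?E * ?I)"
      using nu init by (intro mult_left_mono) auto
    finally show ?thesis .
  qed
  ultimately show ?thesis by (simp add: distrib_right mult.assoc)
qed

end

theorem theorem12:
  fixes \<nu> \<alpha> \<beta> r :: real
  assumes "\<nu> > 0" and "1/2 < \<beta>" and "\<beta> < 5/4" and "\<alpha> + \<beta> = 5/4" and "r > \<beta> + 2"
  shows "\<exists>C :: real \<Rightarrow> real \<Rightarrow> real \<Rightarrow> real \<Rightarrow> real \<Rightarrow> real \<Rightarrow> real.
    \<forall>T (v1 :: real \<Rightarrow> vfield) (v2 :: real \<Rightarrow> vfield) (\<theta>1 :: real \<Rightarrow> sfield) (\<theta>2 :: real \<Rightarrow> sfield)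
      v10 v20 \<theta>10 \<theta>20.
      T > 0 \<and> inV r v10 \<and> inV r v20 \<and> inH (r - \<beta>) \<theta>10 \<and> inH (r - \<beta>) \<theta>20 \<and>
      is_sol \<nu> \<alpha> \<beta> T v1 \<theta>1 v10 \<theta>10 \<and> is_sol \<nu> \<alpha> \<beta> T v2 \<theta>2 v20 \<theta>20 \<and>
      (\<forall>t\<in>{0..T}. inV r (v1 t) \<and> inV r (v2 t) \<and> inH (r - \<beta>) (\<theta>1 t) \<and> inH (r - \<beta>) (\<theta>2 t)) \<and>
      cont_in r v1 T \<and> cont_in r v2 T \<and> cont_in (r - \<beta>) \<theta>1 T \<and> cont_in (r - \<beta>) \<theta>2 T \<and>
      L2fin (r + \<beta>) v1 T \<and> L2fin (r + \<beta>) v2 T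
      \<longrightarrow>
      Linfnorm (r - 1) (\<lambda>t. v1 t - v2 t) T + L2norm (r - 1 + \<beta>) (\<lambda>t. v1 t - v2 t) T
        + Linfnorm (r - \<beta> - 1) (\<lambda>t. \<theta>1 t - \<theta>2 t) T
      \<le> C T (Linfnorm (r - \<beta>) \<theta>1 T) (L2norm (r + \<beta> - 1) v1 T) (L2norm (r + \<beta> - 1) v2 T)
            (Linfnorm r v1 T) (Linfnorm r v2 T)
        * (sobnorm (r - 1) (v10 - v20) + sobnorm (r - \<beta> - 1) (\<theta>10 - \<theta>20))"
proof -
  define s where "s = r - 1"
  define \<sigma> where "\<sigma> = r - \<beta> - 1"
  define p where "p = s + 2 * \<alpha>"
  \<comment> \<open>The bound on \<open>r\<close> gives \<open>\<sigma> > 1\<close> and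
    \<open>s > \<beta> + 1\<close>, while \<open>\<beta> < 5/4\<close> means
    \<open>\<alpha> > 0\<close>, so \<open>p > s\<close>. Substituting
    \<open>\<alpha> = 5/4 - \<beta>\<close> yields p > 7/2 - \<beta> > 9/4.\<close>
  have par: "1 \<le> s" "1 \<le> \<sigma>" "s \<le> p" "\<sigma> \<le> p" "3/2 < p"
    using assms by (auto simp: s_def \<sigma>_def p_def)
  obtain C1 where C1: "conv_const s p C1" using conv_const_exists[of s p] par by auto
  obtain C2 where C2: "conv_const (s - 1) p C2" using conv_const_exists[of "s - 1" p] par by auto
  obtain C3 where C3: "conv_const \<sigma> p C3" using conv_const_exists[of \<sigma> p] par by auto
  obtain C4 where C4: "conv_const (\<sigma> - 1) p C4" using conv_const_exists[of "\<sigma> - 1" p] par by auto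
  \<comment> \<open>A trilinear constant may be enlarged, so the maximum serves all four orders. It
    is fixed before \<open>T\<close> and the solutions, as the order of quantifiers
    requires.\<close>
  define C where "C = max (max C1 C2) (max C3 C4)"
  have C: "conv_const s p C" "conv_const (s - 1) p C" "conv_const \<sigma> p C" "conv_const (\<sigma> - 1) p C"
    using C1 C2 C3 C4 by (auto simp: C_def intro: conv_const_mono)
  \<comment> \<open>This is \<open>growth\<close> as a function of norms, since the witness is named
    before the solutions: \<open>a\<close> is the norm of \<open>\<theta>1\<close>, \<open>b\<close>
    and \<open>c\<close> are those of \<open>v1\<close> and \<open>v2\<close>.\<close>
  let ?K = "\<lambda>a b c. C * (b + c + a) * (12 * s + 4 * \<sigma> + 8) + 1 / \<nu>"
  have r: "s + 1 = r" "\<sigma> + 1 = r - \<beta>" "\<sigma> = s - \<beta>" by (auto simp: s_def \<sigma>_def)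
  show ?thesis
  proof (intro exI[of _ "\<lambda>T a _ _ b c. (2 + sqrt (1 / \<nu>)) * sqrt (exp (?K a b c * T))"] allI impI, elim conjE)
    fix T and v1 v2 :: "real \<Rightarrow> vfield" and \<theta>1 \<theta>2 :: "real \<Rightarrow> sfield" and v10 v20 \<theta>10 \<theta>20
    assume "T > 0" "is_sol \<nu> \<alpha> \<beta> T v1 \<theta>1 v10 \<theta>10" "is_sol \<nu> \<alpha> \<beta> T v2 \<theta>2 v20 \<theta>20"
      "\<forall>t\<in>{0..T}. inV r (v1 t) \<and> inV r (v2 t) \<and> inH (r - \<beta>) (\<theta>1 t) \<and> inH (r - \<beta>) (\<theta>2 t)"
      "cont_in r v1 T" "cont_in r v2 T" "cont_in (r - \<beta>) \<theta>1 T" "cont_in (r - \<beta>) \<theta>2 T"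
    then interpret two_solutions \<nu> \<alpha> \<beta> s \<sigma> p T C v1 v2 \<theta>1 \<theta>2 v10 v20 \<theta>10 \<theta>20
      using assms(1) par C by unfold_locales (auto simp: r(1,2) p_def intro: r(3))
    have "w = (\<lambda>t. v1 t - v2 t)" "\<eta> = (\<lambda>t. \<theta>1 t - \<theta>2 t)" by (auto simp: w_def \<eta>_def)
    then show "Linfnorm (r - 1) (\<lambda>t. v1 t - v2 t) T + L2norm (r - 1 + \<beta>) (\<lambda>t. v1 t - v2 t) T
        + Linfnorm (r - \<beta> - 1) (\<lambda>t. \<theta>1 t - \<theta>2 t) T
      \<le> (2 + sqrt (1 / \<nu>)) * sqrt (exp (?K (Linfnorm (r - \<beta>) \<theta>1 T) (Linfnorm r v1 T) (Linfnorm r v2 T) * T))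
        * (sobnorm (r - 1) (v10 - v20) + sobnorm (r - \<beta> - 1) (\<theta>10 - \<theta>20))"
      using stability unfolding growth_def transport_bound_def r(1,2)
      by (simp only: s_def[symmetric] \<sigma>_def[symmetric])
  qed
qed

end
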